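(* Let $A$ be an affine generalized Cartan matrix and $m\in\mathbb{Z}_{>0}$. Suppose $\mu$ covers $\mu-\delta$ in $(\Lambda^+_m,\leqslant)$. Then one of the following is true: (1) $\mu$ is a fundamental weight corresponding to a special vertex of $S(A)$. (2) $S(A)$ is a non triply laced Dynkin diagram containing a unique short simple root and $\mu$ is a fundamental weight corresponding to that unique short simple root. (3) $A=D_{n+1}^{(2)}$ and $\mu=\omega_0+\omega_n$. (4) $A=A_1^{(1)}$ and $\mu=\omega_0+\omega_1$.
   Context: $A=(a_{ij})_{0\le i,j\le n}$ is an affine generalized Cartan matrix (type names and vertex numbering follow Kac's tables; in $D_{n+1}^{(2)}$ the vertices $0$ and $n$ are the two end nodes), $\mathfrak{g}(A)$ its Kac-Moody algebra with Cartan subalgebra $\mathfrak{h}$, simple roots $\alpha_0,\dots,\alpha_n$, simple coroots $\alpha_0^\vee,\dots,\alpha_n^\vee$, $\alpha_j(\alpha_i^\vee)=a_{ij}$, and Dynkin diagram $S(A)$, whose vertices are identified with $0,\dots,n$. $\delta=\sum_{i=0}^n a_i\alpha_i$ is the canonical imaginary root and $c=\sum_{i=0}^n a_i^\vee\alpha_i^\vee$ the canonical central element, where $a_i$ (resp. $a_i^\vee$) are the standard positive numerical labels of $S(A)$ (resp. $S(A^T)$). $\Lambda^+=\{\lambda\in\mathfrak{h}^*:\lambda(\alpha_i^\vee)\in\mathbb{Z}_{\ge0}\text{ for all }0\le i\le n\}$ is the set of dominant integral weights and $\Lambda^+_m=\{\lambda\in\Lambda^+:\lambda(c)=m\}$.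 The partial order is: $\mu\leqslant\lambda$ iff $\lambda-\mu$ is a non-negative integral sum of simple roots. "$\lambda$ covers $\mu$" means $\mu<\lambda$ and no element of the poset lies strictly between them. A weight $\lambda$ is a fundamental weight corresponding to a vertex $i$ if $\lambda(\alpha_j^\vee)=\delta_{ji}$ (Kronecker delta) for all $j$ (so it is determined only up to adding complex multiples of $\delta$); $\omega_i$ denotes a fundamental weight corresponding to vertex $i$. For a proper connected (nonempty) subdiagram $K$ of $S(A)$, $K$ is of finite type and $\alpha_K$ denotes the highest short root of the corresponding finite root system (in a simply laced root system all roots are considered both short and long). A vertex $i$ of $S(A)$ is called special if $L:=S(A)\setminus\{i\}$ is connected and $\delta=\alpha_L+\alpha_i$. A diagram is triply laced if it contains a triple edge (i.e. $A$ is $G_2^{(1)}$ or $D_4^{(3)}$). *)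

theory Defs
  imports Complex_Main
begin

text \<open>
  A matrix \<open>A = (a\<^sub>i\<^sub>j)\<close> with indices \<open>0, \<dots>, n\<close> is a function on \<^typ>\<open>nat\<close>; only its values at
  indices \<open>\<le> n\<close> matter. The vertices of the Dynkin diagram \<open>S(A)\<close> are \<open>0, \<dots>, n\<close>, and a
  subdiagram is given by its set of vertices.
\<close>

definition gcm :: "nat \<Rightarrow> (nat \<Rightarrow> nat \<Rightarrow> int) \<Rightarrow> bool" where
  "gcm n A \<longleftrightarrow>
     (\<forall>i\<le>n. A i i = 2) \<and>
     (\<forall>i\<le>n. \<forall>j\<le>n. i \<noteq> j \<longrightarrow> A i j \<le> 0) \<and>
     (\<forall>i\<le>n. \<forall>j\<le>n. A i j = 0 \<longrightarrow> A j i = 0)"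

definition connected_diagram :: "(nat \<Rightarrow> nat \<Rightarrow> int) \<Rightarrow> nat set \<Rightarrow> bool" where
  "connected_diagram A K \<longleftrightarrow> K \<noteq> {} \<and>
     (\<forall>i\<in>K. \<forall>j\<in>K. (i, j) \<in> {(p, q). p \<in> K \<and> q \<in> K \<and> p \<noteq> q \<and> A p q \<noteq> 0}\<^sup>*)"

text \<open>
  Type (Aff) of Kac's trichotomy for indecomposable generalized Cartan matrices: there is
  \<open>u > 0\<close> with \<open>A u = 0\<close>; the corank is 1, i.e. the (real) null space is spanned by \<open>u\<close>;
  and \<open>A v \<ge> 0\<close> implies \<open>A v = 0\<close>.
\<close>

definition affine_gcm :: "nat \<Rightarrow> (nat \<Rightarrow> nat \<Rightarrow> int) \<Rightarrow> bool" where
  "affine_gcm n A \<longleftrightarrow> gcm n A \<and> connected_diagram A {..n} \<and>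
     (\<exists>u::nat \<Rightarrow> real.
        (\<forall>i\<le>n. 0 < u i) \<and>
        (\<forall>i\<le>n. (\<Sum>j\<le>n. of_int (A i j) * u j) = 0) \<and>
        (\<forall>v::nat \<Rightarrow> real. (\<forall>i\<le>n. (\<Sum>j\<le>n. of_int (A i j) * v j) = 0) \<longrightarrow>
           (\<exists>t. \<forall>i\<le>n. v i = t * u i))) \<and>
     (\<forall>v::nat \<Rightarrow> real. (\<forall>i\<le>n. 0 \<le> (\<Sum>j\<le>n. of_int (A i j) * v j)) \<longrightarrow>
        (\<forall>i\<le>n. (\<Sum>j\<le>n. of_int (A i j) * v j) = 0))"

definition transposed :: "(nat \<Rightarrow> nat \<Rightarrow> int) \<Rightarrow> nat \<Rightarrow> nat \<Rightarrow> int" where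
  "transposed A = (\<lambda>i j. A j i)"

text \<open>
  The numerical labels of \<open>S(A)\<close> are the unique relatively prime positive integers
  \<open>a\<^sub>0, \<dots>, a\<^sub>n\<close> annihilated by \<open>A\<close>.
\<close>

definition numerical_labels :: "nat \<Rightarrow> (nat \<Rightarrow> nat \<Rightarrow> int) \<Rightarrow> (nat \<Rightarrow> nat) \<Rightarrow> bool" where
  "numerical_labels n A a \<longleftrightarrow>
     (\<forall>i\<le>n. 0 < a i) \<and> Gcd (a ` {..n}) = 1 \<and> (\<forall>i\<le>n. (\<Sum>j\<le>n. A i j * int (a j)) = 0)"

text \<open>
  Two distinct vertices \<open>i, j\<close> are joined by \<open>max \<bar>a\<^sub>i\<^sub>j\<bar> \<bar>a\<^sub>j\<^sub>i\<bar>\<close> edges when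
  \<open>a\<^sub>i\<^sub>j a\<^sub>j\<^sub>i \<le> 4\<close>, which always holds for affine \<open>A\<close>.
\<close>

definition triply_laced :: "nat \<Rightarrow> (nat \<Rightarrow> nat \<Rightarrow> int) \<Rightarrow> bool" where
  "triply_laced n A \<longleftrightarrow> (\<exists>i\<le>n. \<exists>j\<le>n. i \<noteq> j \<and> max \<bar>A i j\<bar> \<bar>A j i\<bar> = 3)"

definition mat_A1_1 :: "nat \<Rightarrow> nat \<Rightarrow> int" where
  "mat_A1_1 i j = (if i = j then 2 else - 2)"

text \<open>
  \<open>D\<^sub>n\<^sub>+\<^sub>1\<^sup>(\<^sup>2\<^sup>)\<close> (for \<open>n \<ge> 2\<close>) in Kac's numbering: the chain \<open>0, 1, \<dots>, n\<close> with double edges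
  at both ends, the arrows pointing to the short end vertices \<open>0\<close> and \<open>n\<close>.
\<close>

definition mat_D_2 :: "nat \<Rightarrow> nat \<Rightarrow> nat \<Rightarrow> int" where
  "mat_D_2 n i j =
     (if i = j then 2
      else if (i = 0 \<and> j = 1) \<or> (i = n \<and> j = n - 1) then - 2
      else if i = j + 1 \<or> j = i + 1 then - 1
      else 0)"

text \<open>
  \<open>\<sigma>\<close> identifies the vertices of the standard matrix \<open>B\<close> with those of \<open>A\<close>; thus vertex \<open>k\<close>
  in the standard numbering is the vertex \<open>\<sigma> k\<close> of \<open>S(A)\<close>.
\<close>

definition numbering :: "nat \<Rightarrow> (nat \<Rightarrow> nat \<Rightarrow> int) \<Rightarrow> (nat \<Rightarrow> nat \<Rightarrow> int) \<Rightarrow> (nat \<Rightarrow> nat) \<Rightarrow> bool" where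
  "numbering n A B \<sigma> \<longleftrightarrow>
     bij_betw \<sigma> {..n} {..n} \<and> (\<forall>i\<le>n. \<forall>j\<le>n. A (\<sigma> i) (\<sigma> j) = B i j)"

text \<open>
  Elements of the root lattice are given by their coordinates with respect to the simple roots.
\<close>

definition simple :: "nat \<Rightarrow> nat \<Rightarrow> int" where
  "simple i = (\<lambda>j. if j = i then 1 else 0)"

definition reflection :: "nat \<Rightarrow> (nat \<Rightarrow> nat \<Rightarrow> int) \<Rightarrow> nat \<Rightarrow> (nat \<Rightarrow> int) \<Rightarrow> nat \<Rightarrow> int" where
  "reflection n A i \<beta> = (\<lambda>j. \<beta> j - (\<Sum>k\<le>n. A i k * \<beta> k) * simple i j)"

text \<open>
  For \<open>K\<close> of finite type all roots are real, so the root system of \<open>K\<close> consists of the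
  images of the simple roots \<open>\<alpha>\<^sub>i\<close>, \<open>i \<in> K\<close>, under the Weyl group of \<open>K\<close>.
\<close>

inductive_set roots :: "nat \<Rightarrow> (nat \<Rightarrow> nat \<Rightarrow> int) \<Rightarrow> nat set \<Rightarrow> (nat \<Rightarrow> int) set"
  for n :: nat and A :: "nat \<Rightarrow> nat \<Rightarrow> int" and K :: "nat set" where
  simple_root: "i \<in> K \<Longrightarrow> simple i \<in> roots n A K"
| reflected_root: "\<beta> \<in> roots n A K \<Longrightarrow> i \<in> K \<Longrightarrow> reflection n A i \<beta> \<in> roots n A K"

text \<open>
  Squared length for the normalized invariant form \<open>(\<alpha>\<^sub>i | \<alpha>\<^sub>j) = a\<^sub>i\<^sup>\<or> a\<^sub>i\<^sup>-\<^sup>1 a\<^sub>i\<^sub>j\<close>. On the root lattice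
  of a proper connected \<open>K\<close> it is, up to a positive factor, the only positive definite form invariant
  under the Weyl group of \<open>K\<close>.
\<close>

definition sq_length ::
  "nat \<Rightarrow> (nat \<Rightarrow> nat \<Rightarrow> int) \<Rightarrow> (nat \<Rightarrow> nat) \<Rightarrow> (nat \<Rightarrow> nat) \<Rightarrow> (nat \<Rightarrow> int) \<Rightarrow> real" where
  "sq_length n A a av \<beta> =
     (\<Sum>i\<le>n. \<Sum>j\<le>n. real (av i) / real (a i) * of_int (A i j) * of_int (\<beta> i) * of_int (\<beta> j))"

definition short_roots ::
  "nat \<Rightarrow> (nat \<Rightarrow> nat \<Rightarrow> int) \<Rightarrow> (nat \<Rightarrow> nat) \<Rightarrow> (nat \<Rightarrow> nat) \<Rightarrow> nat set \<Rightarrow> (nat \<Rightarrow> int) set" where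
  "short_roots n A a av K =
     {\<beta> \<in> roots n A K. \<forall>\<gamma>\<in>roots n A K. sq_length n A a av \<beta> \<le> sq_length n A a av \<gamma>}"

definition highest_short_root ::
  "nat \<Rightarrow> (nat \<Rightarrow> nat \<Rightarrow> int) \<Rightarrow> (nat \<Rightarrow> nat) \<Rightarrow> (nat \<Rightarrow> nat) \<Rightarrow> nat set \<Rightarrow> (nat \<Rightarrow> int) \<Rightarrow> bool" where
  "highest_short_root n A a av K \<beta> \<longleftrightarrow>
     \<beta> \<in> short_roots n A a av K \<and> (\<forall>\<gamma>\<in>short_roots n A a av K. \<forall>j. \<gamma> j \<le> \<beta> j)"

definition special_vertex ::
  "nat \<Rightarrow> (nat \<Rightarrow> nat \<Rightarrow> int) \<Rightarrow> (nat \<Rightarrow> nat) \<Rightarrow> (nat \<Rightarrow> nat) \<Rightarrow> nat \<Rightarrow> bool" where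
  "special_vertex n A a av i \<longleftrightarrow> i \<le> n \<and>
     connected_diagram A ({..n} - {i}) \<and>
     (\<exists>\<theta>. highest_short_root n A a av ({..n} - {i}) \<theta> \<and>
          (\<forall>j\<le>n. int (a j) = \<theta> j + simple i j))"

text \<open>
  Short means of minimal length, also when three root lengths occur (\<open>A\<^sub>2\<^sub>n\<^sup>(\<^sup>2\<^sup>)\<close>, \<open>n \<ge> 2\<close>);
  every real root has the length of some simple root.
\<close>

definition short_simple ::
  "nat \<Rightarrow> (nat \<Rightarrow> nat \<Rightarrow> int) \<Rightarrow> (nat \<Rightarrow> nat) \<Rightarrow> (nat \<Rightarrow> nat) \<Rightarrow> nat \<Rightarrow> bool" where
  "short_simple n A a av i \<longleftrightarrow> i \<le> n \<and>
     (\<forall>j\<le>n. sq_length n A a av (simple i) \<le> sq_length n A a av (simple j))"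

definition dual_space :: "(complex \<Rightarrow> 'h \<Rightarrow> 'h::ab_group_add) \<Rightarrow> ('h \<Rightarrow> complex) set" where
  "dual_space scale = {f. Vector_Spaces.linear scale (*) f}"

text \<open>
  The Cartan subalgebra \<open>\<hh>\<close> of the Kac-Moody algebra (the whole type \<open>'h\<close>), with simple roots
  \<open>\<alpha>\<^sub>i \<in> \<hh>\<^sup>*\<close> and simple coroots \<open>h\<^sub>i = \<alpha>\<^sub>i\<^sup>\<or> \<in> \<hh>\<close>, both linearly independent; its dimension is
  \<open>2 (n + 1) - rank A = n + 2\<close>. As \<open>dim\<close> is \<open>0\<close> for infinite-dimensional spaces, this makes
  \<open>\<hh>\<close> finite-dimensional.
\<close>

definition realization ::
  "nat \<Rightarrow> (nat \<Rightarrow> nat \<Rightarrow> int) \<Rightarrow> (complex \<Rightarrow> 'h \<Rightarrow> 'h::ab_group_add) \<Rightarrow>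
   (nat \<Rightarrow> 'h \<Rightarrow> complex) \<Rightarrow> (nat \<Rightarrow> 'h) \<Rightarrow> bool" where
  "realization n A scale \<alpha> h \<longleftrightarrow>
     vector_space scale \<and> vector_space.dim scale UNIV = n + 2 \<and>
     inj_on h {..n} \<and> \<not> module.dependent scale (h ` {..n}) \<and>
     (\<forall>i\<le>n. \<alpha> i \<in> dual_space scale) \<and>
     (\<forall>t. (\<forall>x. (\<Sum>i\<le>n. t i * \<alpha> i x) = 0) \<longrightarrow> (\<forall>i\<le>n. t i = 0)) \<and>
     (\<forall>i\<le>n. \<forall>j\<le>n. \<alpha> j (h i) = of_int (A i j))"

definition canonical_central ::
  "nat \<Rightarrow> (complex \<Rightarrow> 'h \<Rightarrow> 'h::ab_group_add) \<Rightarrow> (nat \<Rightarrow> nat) \<Rightarrow> (nat \<Rightarrow> 'h) \<Rightarrow> 'h" where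
  "canonical_central n scale av h = (\<Sum>i\<le>n. scale (of_nat (av i)) (h i))"

definition delta :: "nat \<Rightarrow> (nat \<Rightarrow> nat) \<Rightarrow> (nat \<Rightarrow> 'h \<Rightarrow> complex) \<Rightarrow> 'h \<Rightarrow> complex" where
  "delta n a \<alpha> = (\<lambda>x. \<Sum>i\<le>n. of_nat (a i) * \<alpha> i x)"

definition dominant_weights ::
  "nat \<Rightarrow> (complex \<Rightarrow> 'h \<Rightarrow> 'h::ab_group_add) \<Rightarrow> (nat \<Rightarrow> 'h) \<Rightarrow> ('h \<Rightarrow> complex) set" where
  "dominant_weights n scale h = {\<nu> \<in> dual_space scale. \<forall>i\<le>n. \<exists>k::nat. \<nu> (h i) = of_nat k}"

definition dominant_weights_of_level ::
  "nat \<Rightarrow> (complex \<Rightarrow> 'h \<Rightarrow> 'h::ab_group_add) \<Rightarrow> (nat \<Rightarrow> nat) \<Rightarrow> (nat \<Rightarrow> 'h) \<Rightarrow> int \<Rightarrow>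
   ('h \<Rightarrow> complex) set" where
  "dominant_weights_of_level n scale av h m =
     {\<nu> \<in> dominant_weights n scale h. \<nu> (canonical_central n scale av h) = of_int m}"

definition weight_le ::
  "nat \<Rightarrow> (nat \<Rightarrow> 'h \<Rightarrow> complex) \<Rightarrow> ('h \<Rightarrow> complex) \<Rightarrow> ('h \<Rightarrow> complex) \<Rightarrow> bool" where
  "weight_le n \<alpha> \<mu> \<nu> \<longleftrightarrow> (\<exists>k::nat \<Rightarrow> nat. \<forall>x. \<nu> x - \<mu> x = (\<Sum>i\<le>n. of_nat (k i) * \<alpha> i x))"

definition covers_in :: "'a set \<Rightarrow> ('a \<Rightarrow> 'a \<Rightarrow> bool) \<Rightarrow> 'a \<Rightarrow> 'a \<Rightarrow> bool" where
  "covers_in P le x y \<longleftrightarrow> x \<in> P \<and> y \<in> P \<and> le y x \<and> y \<noteq> x \<and>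
     \<not> (\<exists>z\<in>P. le y z \<and> y \<noteq> z \<and> le z x \<and> z \<noteq> x)"

definition fundamental_weight ::
  "nat \<Rightarrow> (complex \<Rightarrow> 'h \<Rightarrow> 'h::ab_group_add) \<Rightarrow> (nat \<Rightarrow> 'h) \<Rightarrow> nat \<Rightarrow> ('h \<Rightarrow> complex) \<Rightarrow> bool" where
  "fundamental_weight n scale h i \<nu> \<longleftrightarrow>
     \<nu> \<in> dual_space scale \<and> (\<forall>j\<le>n. \<nu> (h j) = (if j = i then 1 else 0))"

end

theory Submission
  imports Defs
begin

text \<open>
  If \<open>\<mu>\<close> covers \<open>\<mu> - \<delta>\<close>, then \<open>\<mu> - \<beta>\<close> is dominant for no \<open>\<beta>\<close> in the root lattice
  strictly between \<open>0\<close> and \<open>\<delta>\<close>. Write \<open>c\<^sub>i = \<mu>(\<alpha>\<^sub>i\<^sup>\<or>)\<close>. Taking \<open>\<beta> = \<alpha>\<^sub>i\<close> gives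
  \<open>c\<^sub>i \<le> 1\<close>. If the support of \<open>c\<close> has two elements, let \<open>\<beta>\<close> be the sum of the simple roots
  along a shortest path between two of them: \<open>\<mu> - \<beta>\<close> is dominant, so \<open>\<beta> = \<delta>\<close>, the diagram is
  this path, and \<open>A \<delta> = 0\<close> determines the matrix. If the support is \<open>{j}\<close>, let \<open>L\<close> be a component
  of the diagram without \<open>j\<close> and \<open>\<beta> = \<delta> - \<alpha>\<^sub>L\<close>; non-dominance gives
  \<open>\<alpha>\<^sub>L(\<alpha>\<^sub>j\<^sup>\<or>) \<le> -2\<close>. Since \<open>\<alpha>\<^sub>L + \<alpha>\<^sub>j\<close> has non-negative squared length, either it is
  isotropic, whence equal to \<open>\<delta>\<close> and \<open>j\<close> is special, or \<open>\<alpha>\<^sub>j\<close> is strictly shorter than all of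
  \<open>L\<close>. In the latter case a triple edge from \<open>\<alpha>\<^sub>y\<close> to a shorter \<open>\<alpha>\<^sub>x\<close> forces \<open>j = x\<close>, and
  \<open>\<beta> = 2\<alpha>\<^sub>x + \<alpha>\<^sub>y\<close> yields a contradiction.
\<close>

section \<open>Quadratic forms with vanishing row and column sums, and connectedness\<close>

text \<open>When \<open>(y i - y j)\<^sup>2\<close> is expanded, the pure squares are weighted by
  row and column sums and disappear. With non-positive off-diagonal entries the form is then visibly
  non-negative.\<close>

lemma zero_sums_quadratic:
  fixes P :: "nat \<Rightarrow> nat \<Rightarrow> real"
  assumes "\<And>i. i \<le> n \<Longrightarrow> (\<Sum>j\<le>n. P i j) = 0" "\<And>j. j \<le> n \<Longrightarrow> (\<Sum>i\<le>n. P i j) = 0"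
  shows "(\<Sum>i\<le>n. \<Sum>j\<le>n. P i j * (y i * y j)) = (\<Sum>i\<le>n. \<Sum>j\<le>n. - P i j * (y i - y j)\<^sup>2) / 2"
proof -
  have "(\<Sum>i\<le>n. \<Sum>j\<le>n. P i j * (y i)\<^sup>2) = 0"
    using assms(1) by (simp flip: sum_distrib_right)
  moreover have "(\<Sum>i\<le>n. \<Sum>j\<le>n. P i j * (y j)\<^sup>2) = 0"
    using assms(2) by (subst sum.swap) (simp flip: sum_distrib_right)
  moreover have "(\<Sum>i\<le>n. \<Sum>j\<le>n. - P i j * (y i - y j)\<^sup>2) =
      2 * (\<Sum>i\<le>n. \<Sum>j\<le>n. P i j * (y i * y j)) -
      (\<Sum>i\<le>n. \<Sum>j\<le>n. P i j * (y i)\<^sup>2) - (\<Sum>i\<le>n. \<Sum>j\<le>n. P i j * (y j)\<^sup>2)"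
    unfolding sum_distrib_left sum_subtractf[symmetric]
    by (intro sum.cong refl) (simp add: power2_eq_square algebra_simps)
  ultimately show ?thesis by simp
qed

lemma connected_diagram_insert:
  assumes "connected_diagram A L" "k \<in> L" "v \<noteq> k" "A v k \<noteq> 0" "A k v \<noteq> 0"
  shows "connected_diagram A (insert v L)"
proof -
  define R where "R = (\<lambda>K. {(p, q). p \<in> K \<and> q \<in> K \<and> p \<noteq> q \<and> A p q \<noteq> 0})"
  have conn: "connected_diagram A K \<longleftrightarrow> K \<noteq> {} \<and> (\<forall>i\<in>K. \<forall>j\<in>K. (i, j) \<in> (R K)\<^sup>*)" for K
    by (simp add: connected_diagram_def R_def)
  have "(R L)\<^sup>* \<subseteq> (R (insert v L))\<^sup>*"
    by (rule rtrancl_mono) (auto simp: R_def)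
  then have *: "(i, j) \<in> (R (insert v L))\<^sup>*" if "i \<in> L" "j \<in> L" for i j
    using assms(1) that unfolding conn by blast
  have "(v, k) \<in> R (insert v L)" "(k, v) \<in> R (insert v L)"
    using assms by (auto simp: R_def)
  then have "(v, j) \<in> (R (insert v L))\<^sup>*" "(j, v) \<in> (R (insert v L))\<^sup>*" if "j \<in> L" for j
    using *[OF \<open>k \<in> L\<close> that] *[OF that \<open>k \<in> L\<close>]
    by (auto intro: converse_rtrancl_into_rtrancl rtrancl_into_rtrancl)
  then show ?thesis
    using * unfolding conn by auto
qed

text \<open>A maximal connected subset of \<open>X\<close> containing \<open>i\<close> works, since
  any adjacent vertex of \<open>X\<close> could be added to it.\<close>

lemma connected_component_exists:
  assumes "finite X" "i \<in> X" "\<And>p q. p \<in> X \<Longrightarrow> q \<in> X \<Longrightarrow> A p q \<noteq> 0 \<Longrightarrow> A q p \<noteq> 0"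
  obtains L where "L \<subseteq> X" "i \<in> L" "connected_diagram A L"
    "\<And>v k. v \<in> X - L \<Longrightarrow> k \<in> L \<Longrightarrow> A v k = 0"
proof -
  define F where "F = {L. L \<subseteq> X \<and> i \<in> L \<and> connected_diagram A L}"
  have "finite F" using assms(1) by (auto simp: F_def)
  moreover have "{i} \<in> F" using assms(2) by (auto simp: F_def connected_diagram_def)
  ultimately obtain L where L: "L \<in> F" "\<And>K. K \<in> F \<Longrightarrow> L \<subseteq> K \<Longrightarrow> K = L"
    using finite_has_maximal2[of F "{i}"] by blast
  have "A v k = 0" if "v \<in> X - L" "k \<in> L" for v k
  proof (rule ccontr)
    assume "A v k \<noteq> 0"
    then have "connected_diagram A (insert v L)"
      using connected_diagram_insert[of A L k v] that L(1) assms(3)[of v k]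
      by (auto simp: F_def)
    then have "insert v L \<in> F" using L(1) that by (auto simp: F_def)
    then show False using L(2) that by blast
  qed
  then show ?thesis using that L(1) by (auto simp: F_def)
qed

lemma connected_diagram_neighbour:
  assumes "connected_diagram A S" "X \<subseteq> S" "X \<noteq> {}" "X \<noteq> S"
  obtains x z where "x \<in> X" "z \<in> S" "z \<notin> X" "A x z \<noteq> 0"
proof -
  obtain x y where xy: "x \<in> X" "y \<in> S" "y \<notin> X" using assms by blast
  define R where "R = {(p, q). p \<in> S \<and> q \<in> S \<and> p \<noteq> q \<and> A p q \<noteq> 0}"
  have "(x, y) \<in> R\<^sup>*" using assms xy unfolding connected_diagram_def R_def by blast
  then have "\<exists>p q. p \<in> X \<and> q \<notin> X \<and> (p, q) \<in> R"
    using xy(3)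
  proof (induction rule: rtrancl_induct)
    case base
    then show ?case using xy(1) by blast
  next
    case (step p q)
    then show ?case by blast
  qed
  then show ?thesis using that by (auto simp: R_def)
qed

section \<open>The invariant form\<close>

text \<open>The positive null vectors \<open>a\<close> of \<open>A\<close> and \<open>av\<close> of
  its transpose replace the classification of affine diagrams.\<close>

locale affine_diagram =
  fixes n :: nat and A :: "nat \<Rightarrow> nat \<Rightarrow> int" and a av :: "nat \<Rightarrow> nat"
  assumes gcm: "gcm n A"
    and connected: "connected_diagram A {..n}"
    and labels: "numerical_labels n A a"
    and colabels: "numerical_labels n (transposed A) av"
begin

lemma A_diag: "i \<le> n \<Longrightarrow> A i i = 2"
  using gcm by (simp add: gcm_def)

lemma A_le_0: "i \<le> n \<Longrightarrow> j \<le> n \<Longrightarrow> i \<noteq> j \<Longrightarrow> A i j \<le> 0"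
  using gcm by (simp add: gcm_def)

lemma A_zero_sym: "i \<le> n \<Longrightarrow> j \<le> n \<Longrightarrow> A i j = 0 \<longleftrightarrow> A j i = 0"
  using gcm by (auto simp: gcm_def)

lemma a_pos: "i \<le> n \<Longrightarrow> 0 < a i"
  using labels by (simp add: numerical_labels_def)

lemma av_pos: "i \<le> n \<Longrightarrow> 0 < av i"
  using colabels by (simp add: numerical_labels_def)

text \<open>The value of the root lattice element \<open>x\<close> on the \<open>i\<close>-th simple
  coroot.\<close>

definition pairing :: "(nat \<Rightarrow> int) \<Rightarrow> nat \<Rightarrow> int" where
  "pairing x i = (\<Sum>k\<le>n. A i k * x k)"

text \<open>Half the squared length of the simple root \<open>i\<close>, see
  \<open>sq_simple\<close>.\<close>

definition d :: "nat \<Rightarrow> real" where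
  "d i = real (av i) / real (a i)"

abbreviation sq :: "(nat \<Rightarrow> int) \<Rightarrow> real" where
  "sq \<equiv> sq_length n A a av"

lemma d_pos: "i \<le> n \<Longrightarrow> 0 < d i"
  using a_pos av_pos by (simp add: d_def)

lemma pairing_labels: "i \<le> n \<Longrightarrow> pairing (\<lambda>k. int (a k)) i = 0"
  using labels by (simp add: numerical_labels_def pairing_def)

text \<open>Scaling rows and columns of \<open>A\<close> by the labels makes all row and column sums
  zero, as for a weighted graph Laplacian.\<close>

definition P :: "nat \<Rightarrow> nat \<Rightarrow> real" where
  "P i j = real (av i) * of_int (A i j) * real (a j)"

lemma P_row: assumes "i \<le> n" shows "(\<Sum>j\<le>n. P i j) = 0"
proof -
  have "(\<Sum>j\<le>n. P i j) = real (av i) * of_int (\<Sum>j\<le>n. A i j * int (a j))"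
    by (simp add: P_def sum_distrib_left mult_ac)
  moreover have "(\<Sum>j\<le>n. A i j * int (a j)) = 0"
    using labels assms by (simp add: numerical_labels_def)
  ultimately show ?thesis by (simp only: of_int_0 mult_zero_right)
qed

lemma P_col: assumes "j \<le> n" shows "(\<Sum>i\<le>n. P i j) = 0"
proof -
  have "(\<Sum>i\<le>n. P i j) = real (a j) * of_int (\<Sum>i\<le>n. A i j * int (av i))"
    by (simp add: P_def sum_distrib_left mult_ac)
  moreover have "(\<Sum>i\<le>n. A i j * int (av i)) = 0"
    using colabels assms by (simp add: numerical_labels_def transposed_def)
  ultimately show ?thesis by (simp only: of_int_0 mult_zero_right)
qed

lemma P_le_0: "i \<le> n \<Longrightarrow> j \<le> n \<Longrightarrow> i \<noteq> j \<Longrightarrow> P i j \<le> 0"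
  using A_le_0[of i j] by (simp add: P_def mult_nonneg_nonpos mult_nonpos_nonneg)

lemma P_term_nonneg: "i \<le> n \<Longrightarrow> j \<le> n \<Longrightarrow> 0 \<le> - P i j * (y i - y j)\<^sup>2"
  using P_le_0[of i j] by (cases "i = j") (auto simp: mult_nonpos_nonneg)

lemma P_quadratic_nonneg: "0 \<le> (\<Sum>i\<le>n. \<Sum>j\<le>n. P i j * (y i * y j))"
proof -
  have "0 \<le> (\<Sum>i\<le>n. \<Sum>j\<le>n. - P i j * (y i - y j)\<^sup>2)"
    by (intro sum_nonneg P_term_nonneg) auto
  then show ?thesis
    using zero_sums_quadratic[OF P_row P_col, of y] by simp
qed

text \<open>
  The differences \<open>P i j - P j i\<close> form a circulation, so a vertex on its support \<open>C\<close> has at least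
  two neighbours along it. By the arithmetic-geometric mean inequality, strict where
  \<open>P i j \<noteq> P j i\<close>, and \<open>A i j * A j i \<ge> 1\<close>, the quadratic form of \<open>P\<close> would then be negative at
  the vector with entries \<open>1 / sqrt (a i * av i)\<close> on \<open>C\<close>.
\<close>

lemma P_sym: assumes "i0 \<le> n" "j0 \<le> n" shows "P i0 j0 = P j0 i0"
proof (rule ccontr)
  assume neq: "P i0 j0 \<noteq> P j0 i0"
  define C where "C = {i. i \<le> n \<and> (\<exists>j\<le>n. P i j \<noteq> P j i)}"
  define D where "D = (\<lambda>i. real (av i) * real (a i))"
  define y where "y = (\<lambda>i. if i \<in> C then 1 / sqrt (D i) else 0)"
  define Q where "Q = (\<lambda>i j. (P i j + P j i) / 2 * (y i * y j))"
  have D: "0 < D i" if "i \<le> n" for i using a_pos[OF that] av_pos[OF that] by (simp add: D_def)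
  have Q_edge: "Q i j < - 1" if ij: "i \<le> n" "j \<le> n" "P i j \<noteq> P j i" for i j
  proof -
    have ne: "i \<noteq> j" using ij by auto
    have C: "i \<in> C" "j \<in> C" using ij by (auto simp: C_def)
    have "A i j \<noteq> 0 \<or> A j i \<noteq> 0" using ij by (auto simp: P_def)
    then have "A i j \<le> - 1" "A j i \<le> - 1"
      using A_zero_sym[OF ij(1,2)] A_le_0[of i j] A_le_0[of j i] ij ne by force+
    then have "1 \<le> (- A i j) * (- A j i)" using mult_mono[of 1 "- A i j" 1 "- A j i"] by simp
    then have "1 \<le> real_of_int (A i j * A j i)" by linarith
    then have "D i * D j * 1 \<le> D i * D j * real_of_int (A i j * A j i)"
      using D[of i] D[of j] ij by (intro mult_left_mono) auto
    then have PP: "D i * D j \<le> P i j * P j i" by (simp add: P_def D_def mult_ac)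
    have "0 < (P i j - P j i)\<^sup>2" using ij by simp
    then have "4 * (P i j * P j i) < (- (P i j + P j i))\<^sup>2"
      by (simp add: power2_eq_square algebra_simps)
    then have "4 * (D i * D j) < (- (P i j + P j i))\<^sup>2" using PP by linarith
    moreover have "0 \<le> - (P i j + P j i)" using P_le_0[of i j] P_le_0[of j i] ij ne by auto
    ultimately have "sqrt (4 * (D i * D j)) < - (P i j + P j i)" by (intro real_less_lsqrt)
    then have "2 * (sqrt (D i) * sqrt (D j)) < - (P i j + P j i)"
      by (simp add: real_sqrt_mult)
    moreover have "0 < sqrt (D i) * sqrt (D j)" using D ij by simp
    ultimately have "2 < - (P i j + P j i) / (sqrt (D i) * sqrt (D j))"
      by (subst pos_less_divide_eq) auto
    moreover have "- 2 * Q i j = - (P i j + P j i) / (sqrt (D i) * sqrt (D j))"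
      using C by (simp add: Q_def y_def add_divide_distrib diff_divide_distrib mult_ac)
    ultimately have "2 < - 2 * Q i j" by (simp only:)
    then show ?thesis by simp
  qed
  have Q_nonpos: "Q i j \<le> 0" if "i \<le> n" "j \<le> n" "i \<noteq> j" for i j
  proof -
    have "0 \<le> y k" if "k \<le> n" for k using D[OF that] by (simp add: y_def)
    then have "0 \<le> y i * y j" using that by simp
    moreover have "(P i j + P j i) / 2 \<le> 0" using P_le_0[of i j] P_le_0[of j i] that by auto
    ultimately show ?thesis by (simp add: Q_def mult_nonpos_nonneg)
  qed
  have Q_row: "(\<Sum>j\<le>n. Q i j) < 0" if i: "i \<in> C" for i
  proof -
    obtain j where j: "j \<le> n" "P i j \<noteq> P j i" and "i \<le> n" using i by (auto simp: C_def)
    have "\<exists>k\<le>n. k \<noteq> j \<and> P i k \<noteq> P k i"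
    proof (rule ccontr)
      assume "\<not> ?thesis"
      then have "(\<Sum>k\<in>{..n} - {j}. P i k - P k i) = 0" by (intro sum.neutral) auto
      then have "(\<Sum>k\<le>n. P i k - P k i) = P i j - P j i"
        using j by (simp add: sum.remove[of "{..n}" j])
      then show False using j P_row[OF \<open>i \<le> n\<close>] P_col[OF \<open>i \<le> n\<close>] by (simp add: sum_subtractf)
    qed
    then obtain k where k: "k \<le> n" "k \<noteq> j" "P i k \<noteq> P k i" by blast
    have ne: "i \<noteq> j" "i \<noteq> k" using j k by auto
    \<comment> \<open>The diagonal contributes 2 and each of the two edges of the circulation less
      than -1.\<close>
    have "Q i i = 2"
      using i D[OF \<open>i \<le> n\<close>] A_diag[OF \<open>i \<le> n\<close>]
      by (simp add: Q_def y_def P_def D_def[symmetric] field_simps)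
         (simp add: D_def)
    moreover have "(\<Sum>l\<in>{..n} - {i} - {j} - {k}. Q i l) \<le> 0"
      using Q_nonpos[OF \<open>i \<le> n\<close>] by (intro sum_nonpos) auto
    moreover have "(\<Sum>l\<le>n. Q i l) = Q i i + (Q i j + (Q i k + (\<Sum>l\<in>{..n} - {i} - {j} - {k}. Q i l)))"
      using \<open>i \<le> n\<close> j(1) k(1,2) ne
      by (simp add: sum.remove[of "{..n}" i] sum.remove[of "{..n} - {i}" j]
          sum.remove[of "{..n} - {i} - {j}" k])
    ultimately show ?thesis using Q_edge[OF \<open>i \<le> n\<close> j] Q_edge[OF \<open>i \<le> n\<close> k(1,3)] by simp
  qed
  have "(\<Sum>i\<le>n. \<Sum>j\<le>n. P i j * (y i * y j)) = (\<Sum>i\<le>n. \<Sum>j\<le>n. P j i * (y i * y j))"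
    by (subst sum.swap) (simp add: mult_ac)
  then have "(\<Sum>i\<le>n. \<Sum>j\<le>n. P i j * (y i * y j)) = (\<Sum>i\<le>n. \<Sum>j\<le>n. Q i j)"
    by (simp add: Q_def sum.distrib ring_distribs add_divide_distrib flip: sum_divide_distrib)
  moreover have "(\<Sum>i\<le>n. \<Sum>j\<le>n. Q i j) < (\<Sum>i\<le>n. 0)"
  proof (rule sum_strict_mono_ex1)
    show "\<forall>i\<in>{..n}. (\<Sum>j\<le>n. Q i j) \<le> 0"
    proof
      fix i
      show "(\<Sum>j\<le>n. Q i j) \<le> 0"
        using Q_row[of i] by (cases "i \<in> C") (auto simp: Q_def y_def intro: less_imp_le)
    qed
    show "\<exists>i\<in>{..n}. (\<Sum>j\<le>n. Q i j) < 0"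
      using Q_row[of i0] neq assms by (auto simp: C_def)
  qed simp
  ultimately show False using P_quadratic_nonneg[of y] by simp
qed

text \<open>This is \<open>P_sym\<close> divided by \<open>a i * a j\<close>; it makes the form
  behind \<open>sq_length\<close> symmetric.\<close>

lemma dA_sym: assumes "i \<le> n" "j \<le> n" shows "d i * of_int (A i j) = d j * of_int (A j i)"
  using P_sym[OF assms] a_pos[OF assms(1)] a_pos[OF assms(2)]
  by (simp add: P_def d_def field_simps)

lemma sq_pairing: "sq x = (\<Sum>i\<le>n. d i * of_int (x i) * of_int (pairing x i))"
  unfolding sq_length_def pairing_def of_int_sum sum_distrib_left
  by (intro sum.cong refl) (simp add: d_def)

lemma pairing_add_simple:
  assumes "i \<le> n"
  shows "pairing (\<lambda>j. x j + k * simple i j) p = pairing x p + k * A p i"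
proof -
  have "pairing (\<lambda>j. x j + k * simple i j) p = pairing x p + (\<Sum>j\<le>n. if j = i then k * A p i else 0)"
    unfolding pairing_def sum.distrib[symmetric]
    by (intro sum.cong refl) (simp add: simple_def algebra_simps)
  then show ?thesis using assms by simp
qed

text \<open>Polarisation: by \<open>dA_sym\<close> the two cross terms agree. At
  \<open>k = - pairing x i\<close> the increments cancel, which gives invariance under
  reflections.\<close>

lemma sq_add_simple:
  assumes "i \<le> n"
  shows "sq (\<lambda>j. x j + k * simple i j) =
    sq x + 2 * of_int k * d i * of_int (pairing x i) + 2 * (of_int k)\<^sup>2 * d i"
proof -
  let ?x = "\<lambda>j. x j + k * simple i j"
  have "sq ?x = (\<Sum>p\<le>n. d p * of_int (x p) * of_int (pairing x p) +
      (of_int k * (d i * of_int (A i p) * of_int (x p)) +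
      (if p = i then of_int k * d i * of_int (pairing ?x i) else 0)))"
    unfolding sq_pairing
  proof (intro sum.cong refl)
    fix p assume "p \<in> {..n}"
    then show "d p * of_int (?x p) * of_int (pairing ?x p) = 
      d p * of_int (x p) * of_int (pairing x p) +
      (of_int k * (d i * of_int (A i p) * of_int (x p)) +
      (if p = i then of_int k * d i * of_int (pairing ?x i) else 0))"
      using dA_sym[OF assms, of p] unfolding pairing_add_simple[OF assms]
      by (simp add: simple_def algebra_simps)
  qed
  also have "\<dots> = sq x + of_int k * d i * of_int (pairing x i) + of_int k * d i * of_int (pairing ?x i)"
    using assms by (simp add: sum.distrib sq_pairing pairing_def sum_distrib_left mult_ac)
  finally show ?thesis
    by (simp add: pairing_add_simple[OF assms] A_diag[OF assms] power2_eq_square algebra_simps)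
qed

lemma sq_P: "sq x = (\<Sum>i\<le>n. \<Sum>j\<le>n. P i j * ((of_int (x i) / real (a i)) * (of_int (x j) / real (a j))))"
  unfolding sq_length_def
proof (intro sum.cong refl)
  fix i j assume "i \<in> {..n}" "j \<in> {..n}"
  then show "real (av i) / real (a i) * real_of_int (A i j) * real_of_int (x i) * real_of_int (x j) =
    P i j * ((of_int (x i) / real (a i)) * (of_int (x j) / real (a j)))"
    using a_pos[of i] a_pos[of j] by (simp add: P_def)
qed

lemma sq_nonneg: "0 \<le> sq x"
  unfolding sq_P by (rule P_quadratic_nonneg)

text \<open>Every term of the sum of squares vanishes, so \<open>x i / a i\<close> agrees at the two
  ends of each edge and is constant by connectedness.\<close>

lemma isotropic:
  assumes "sq x \<le> 0"
  obtains t where "\<And>i. i \<le> n \<Longrightarrow> of_int (x i) = t * real (a i)"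
proof -
  define y where "y = (\<lambda>i. of_int (x i) / real (a i))"
  have *: "(\<Sum>i\<le>n. \<Sum>j\<le>n. - P i j * (y i - y j)\<^sup>2) = 0"
    using assms sq_nonneg[of x] zero_sums_quadratic[OF P_row P_col, of y]
    by (simp add: sq_P y_def)
  then have zero: "- P i j * (y i - y j)\<^sup>2 = 0" if "i \<le> n" "j \<le> n" for i j
  proof -
    have "(\<Sum>j\<le>n. - P i j * (y i - y j)\<^sup>2) = 0"
      by (rule sum_nonneg_0[OF _ _ *]) (use that in \<open>auto intro!: sum_nonneg P_term_nonneg simp del: mult_minus_left\<close>)
    then show ?thesis
      by (rule sum_nonneg_0[rotated 2]) (use that in \<open>auto intro!: P_term_nonneg simp del: mult_minus_left\<close>)
  qed
  have edge: "y i = y j" if "i \<le> n" "j \<le> n" "A i j \<noteq> 0" for i j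
    using zero[OF that(1,2)] that a_pos av_pos by (force simp: P_def)
  have "y i = y 0" if "i \<le> n" for i
  proof -
    have "(0, i) \<in> {(p, q). p \<in> {..n} \<and> q \<in> {..n} \<and> p \<noteq> q \<and> A p q \<noteq> 0}\<^sup>*"
      using connected that unfolding connected_diagram_def by blast
    then show ?thesis by (induction rule: rtrancl_induct) (use edge in force)+
  qed
  then have "of_int (x i) = y 0 * real (a i)" if "i \<le> n" for i
    using a_pos[OF that] that by (metis y_def nonzero_eq_divide_eq of_nat_0_less_iff order_less_irrefl)
  then show ?thesis using that by blast
qed

lemma sq_simple: assumes "i \<le> n" shows "sq (simple i) = 2 * d i"
  using sq_add_simple[OF assms, of "\<lambda>_. 0" 1]
  by (simp add: sq_length_def pairing_def)

section \<open>Highest short roots\<close>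

text \<open>Raising coordinates other than \<open>i\<close> adds only multiples of off-diagonal
  entries, which are non-positive.\<close>

lemma pairing_antimono:
  assumes "i \<le> n" "\<And>j. j \<le> n \<Longrightarrow> x j \<le> y j" "x i = y i"
  shows "pairing y i \<le> pairing x i"
  unfolding pairing_def
proof (rule sum_mono)
  fix j assume "j \<in> {..n}"
  then show "A i j * y j \<le> A i j * x j"
    using assms A_le_0[of i j] by (cases "i = j") (auto intro: mult_left_mono_neg)
qed

lemma pairing_uminus: "pairing (\<lambda>j. - x j) i = - pairing x i"
  by (simp add: pairing_def sum_negf)

lemma pairing_diff: "pairing (\<lambda>j. x j - y j) i = pairing x i - pairing y i"
  by (simp add: pairing_def sum_subtractf right_diff_distrib)

lemma pairing_simple: "i \<le> n \<Longrightarrow> pairing (simple i) p = A p i"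
  using pairing_add_simple[of i "\<lambda>_. 0" 1 p] by (simp add: pairing_def)

lemma reflection_eq: "reflection n A i x = (\<lambda>j. x j + (- pairing x i) * simple i j)"
  by (simp add: reflection_def pairing_def)

lemma sq_reflection: assumes "i \<le> n" shows "sq (reflection n A i x) = sq x"
  unfolding reflection_eq sq_add_simple[OF assms] by (simp add: power2_eq_square)

text \<open>
  The set below is closed under componentwise minimum, hence has a least element; this turns out
  to be the highest short root.
\<close>

definition dominant_on :: "nat set \<Rightarrow> (nat \<Rightarrow> int) set" where
  "dominant_on L = {x. (\<forall>j. 0 \<le> x j) \<and> (\<forall>j. j \<notin> L \<longrightarrow> x j = 0) \<and> (\<exists>j. x j \<noteq> 0) \<and>
     (\<forall>i\<in>L. 0 \<le> pairing x i)}"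

text \<open>Positivity spreads along edges: a zero coordinate next to a positive one would make the
  pairing there negative.\<close>

lemma dominant_full_support:
  assumes "connected_diagram A L" "L \<subseteq> {..n}" "x \<in> dominant_on L" "i \<in> L"
  shows "0 < x i"
proof -
  have x: "0 \<le> x j" "j \<notin> L \<Longrightarrow> x j = 0" "j \<in> L \<Longrightarrow> 0 \<le> pairing x j" for j
    using assms(3) by (auto simp: dominant_on_def)
  obtain k where "x k \<noteq> 0" using assms(3) by (auto simp: dominant_on_def)
  then have k: "k \<in> L" "0 < x k" using x[of k] by auto
  have "(k, i) \<in> {(p, q). p \<in> L \<and> q \<in> L \<and> p \<noteq> q \<and> A p q \<noteq> 0}\<^sup>*"
    using assms(1,4) k unfolding connected_diagram_def by blast
  then show ?thesis
  proof (induction rule: rtrancl_induct)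
    case base
    show ?case by fact
  next
    case (step p q)
    then have pq: "p \<in> L" "q \<in> L" "p \<noteq> q" "A p q \<noteq> 0" and le: "p \<le> n" "q \<le> n"
      using assms(2) by auto
    show ?case
    proof (rule ccontr)
      assume "\<not> ?thesis"
      then have "x q = 0" using x(1)[of q] by simp
      have "A q p < 0" using A_zero_sym[OF le] A_le_0[of q p] pq le by force
      then have "A q p * x p < 0" using step.IH by (simp add: mult_neg_pos)
      moreover have "(\<Sum>j\<in>{..n} - {p}. A q j * x j) \<le> 0"
        using A_le_0[OF le(2)] x(1) \<open>x q = 0\<close>
        by (intro sum_nonpos) (metis DiffE atMost_iff mult_nonpos_nonneg mult_zero_right)
      ultimately have "pairing x q < 0"
        using le by (simp add: pairing_def sum.remove[of "{..n}" p])
      then show False using x(3)[OF pq(2)] by simp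
    qed
  qed
qed

text \<open>Restricting \<delta> to \<open>L\<close> drops only non-positive terms from a vanishing
  sum. Thus \<open>dominant_on L\<close> is nonempty, and its least element will be bounded by the
  labels.\<close>

lemma labels_dominant:
  assumes "L \<subseteq> {..n}" "L \<noteq> {}"
  shows "(\<lambda>j. if j \<in> L then int (a j) else 0) \<in> dominant_on L"
proof -
  have "0 \<le> pairing (\<lambda>j. if j \<in> L then int (a j) else 0) i" if "i \<in> L" for i
  proof -
    have "i \<le> n" using that assms by auto
    then show ?thesis
      using pairing_antimono[of i "\<lambda>j. if j \<in> L then int (a j) else 0" "\<lambda>j. int (a j)"]
        pairing_labels[of i] that by simp
  qed
  moreover obtain i where "i \<in> L" "i \<le> n" using assms by auto
  ultimately show ?thesis using assms a_pos[of i] by (auto simp: dominant_on_def intro!: exI[of _ i])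
qed

text \<open>At each vertex the minimum agrees with \<open>x\<close> or \<open>y\<close> and lies
  below it elsewhere, so \<open>pairing_antimono\<close> applies. Full support keeps the minimum
  nonzero.\<close>

lemma dominant_min:
  assumes "connected_diagram A L" "L \<subseteq> {..n}" "x \<in> dominant_on L" "y \<in> dominant_on L"
  shows "(\<lambda>j. min (x j) (y j)) \<in> dominant_on L"
proof -
  obtain i where "i \<in> L" using assms(1) by (auto simp: connected_diagram_def)
  have "0 < min (x i) (y i)" using dominant_full_support[OF assms(1,2) _ \<open>i \<in> L\<close>] assms(3,4) by simp
  moreover have "0 \<le> pairing (\<lambda>j. min (x j) (y j)) i" if "i \<in> L" for i
  proof (cases "x i \<le> y i")
    case True
    have "pairing x i \<le> pairing (\<lambda>j. min (x j) (y j)) i"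
      using True that assms(2) by (intro pairing_antimono) auto
    then show ?thesis using assms(3) that by (force simp: dominant_on_def)
  next
    case False
    have "pairing y i \<le> pairing (\<lambda>j. min (x j) (y j)) i"
      using False that assms(2) by (intro pairing_antimono) auto
    then show ?thesis using assms(4) that by (force simp: dominant_on_def)
  qed
  ultimately show ?thesis using assms(3,4) unfolding dominant_on_def
    by (auto intro!: exI[of _ i])
qed

lemma least_dominant_exists:
  assumes "connected_diagram A L" "L \<subseteq> {..n}"
  obtains g where "g \<in> dominant_on L" "\<And>x j. x \<in> dominant_on L \<Longrightarrow> g j \<le> x j"
proof -
  define N where "N = (\<lambda>x :: nat \<Rightarrow> int. nat (\<Sum>j\<le>n. x j))"
  have "L \<noteq> {}" using assms(1) by (simp add: connected_diagram_def)
  from labels_dominant[OF assms(2) this] obtain g where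
    g: "g \<in> dominant_on L" and least: "\<And>x. x \<in> dominant_on L \<Longrightarrow> N g \<le> N x"
    using ex_has_least_nat[of "\<lambda>x. x \<in> dominant_on L"] by metis
  have "g j \<le> x j" if x: "x \<in> dominant_on L" for x j
  proof (rule ccontr)
    assume neg: "\<not> ?thesis"
    have nn: "0 \<le> g k" "0 \<le> x k" for k using g x by (auto simp: dominant_on_def)
    have "j \<le> n" using neg g assms(2) nn(2)[of j] by (force simp: dominant_on_def)
    then have "(\<Sum>k\<le>n. min (g k) (x k)) < (\<Sum>k\<le>n. g k)"
      using neg by (intro sum_strict_mono_ex1) (auto intro!: bexI[of _ j])
    moreover have "0 \<le> (\<Sum>k\<le>n. min (g k) (x k))" using nn by (intro sum_nonneg) simp
    ultimately have "N (\<lambda>k. min (g k) (x k)) < N g" by (simp add: N_def)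
    then show False using least[OF dominant_min[OF assms g x]] by simp
  qed
  then show ?thesis using that g by blast
qed

end

text \<open>The vertex \<open>i0\<close> records the length of the short roots of \<open>L\<close>:
  their squared length is \<open>2 * d i0\<close>.\<close>

locale finite_subdiagram = affine_diagram +
  fixes L :: "nat set" and g :: "nat \<Rightarrow> int" and i0 :: nat
  assumes L_connected: "connected_diagram A L"
    and L_proper: "L \<subset> {..n}"
    and g_dominant: "g \<in> dominant_on L"
    and g_least: "x \<in> dominant_on L \<Longrightarrow> g j \<le> x j"
    and i0: "i0 \<in> L"
    and i0_short: "i \<in> L \<Longrightarrow> d i0 \<le> d i"
begin

lemma L_le: "i \<in> L \<Longrightarrow> i \<le> n"
  using L_proper by auto

lemma g_outside: "j \<notin> L \<Longrightarrow> g j = 0"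
  using g_dominant by (simp add: dominant_on_def)

lemma g_nonneg: "0 \<le> g j"
  using g_dominant by (simp add: dominant_on_def)

lemma g_pairing: "i \<in> L \<Longrightarrow> 0 \<le> pairing g i"
  using g_dominant by (simp add: dominant_on_def)

lemma g_pos: "i \<in> L \<Longrightarrow> 0 < g i"
  using dominant_full_support[OF L_connected _ g_dominant] L_proper by auto

lemma g_le_labels: "j \<in> L \<Longrightarrow> g j \<le> int (a j)"
  using g_least[OF labels_dominant, of j] L_proper i0 by auto

text \<open>The form is definite on vectors supported in \<open>L\<close>: an isotropic one is a
  multiple of the labels and vanishes at some vertex outside \<open>L\<close>.\<close>

lemma isotropic_zero:
  assumes "sq x \<le> 0" "\<And>j. j \<notin> L \<Longrightarrow> x j = 0"
  shows "x j = 0"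
proof -
  obtain k where k: "k \<le> n" "k \<notin> L" using L_proper by auto
  obtain t where t: "\<And>i. i \<le> n \<Longrightarrow> of_int (x i) = t * real (a i)"
    using isotropic[OF assms(1)] by blast
  have "t = 0" using t[OF k(1)] a_pos[OF k(1)] assms(2)[OF k(2)] by simp
  then show ?thesis using t[of j] assms(2)[of j] L_le[of j] by (cases "j \<in> L") auto
qed

text \<open>This stands in for Cauchy-Schwarz: adding the simple root \<open>i\<close> to
  \<open>x\<close> gives squared length at most \<open>2 * (d i0 - d i)\<close>, which is
  non-positive, so the sum is zero.\<close>

lemma short_pairing_le_neg_2:
  assumes "sq x = 2 * d i0" "\<And>j. j \<notin> L \<Longrightarrow> x j = 0" "i \<in> L" "pairing x i \<le> - 2"
  shows "x = (\<lambda>j. - simple i j)"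
proof
  fix j
  have "d i * of_int (pairing x i) \<le> d i * (- 2)"
    using assms(4) d_pos[OF L_le[OF assms(3)]] by (intro mult_left_mono) auto
  then have "sq (\<lambda>j. x j + 1 * simple i j) \<le> 0"
    unfolding sq_add_simple[OF L_le[OF assms(3)]]
    using i0_short[OF assms(3)] assms(1) by simp
  moreover have "x j + 1 * simple i j = 0" if "j \<notin> L" for j
    using that assms(2,3) by (auto simp: simple_def)
  ultimately have "x j + 1 * simple i j = 0" by (rule isotropic_zero)
  then show "x j = - simple i j" by simp
qed

text \<open>A pairing of absolute value at least 2 forces \<open>x\<close> to be plus or minus a
  simple root. Otherwise only coordinate \<open>i\<close> moves, by at most 1.\<close>

lemma short_between_reflection:
  assumes "sq x = 2 * d i0" "\<And>j. j \<notin> L \<Longrightarrow> x j = 0" "i \<in> L"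
    and le: "\<And>j. x j \<le> g j" and ge: "\<And>j. - g j \<le> x j"
  shows "reflection n A i x j \<le> g j \<and> - g j \<le> reflection n A i x j"
proof -
  note i = L_le[OF assms(3)]
  have sq': "sq (\<lambda>j. - x j) = 2 * d i0" using assms(1) by (simp add: sq_length_def)
  have si: "simple i j \<le> g j" "- simple i j \<le> g j" for j
    using g_pos[OF assms(3)] g_nonneg[of j] by (auto simp: simple_def)
  consider "pairing x i \<le> - 2" | "pairing x i = - 1" | "pairing x i = 0" | "pairing x i = 1"
    | "2 \<le> pairing x i" by linarith
  then show ?thesis
  proof cases
    case 1
    from short_pairing_le_neg_2[OF assms(1,2,3) this] have "x = (\<lambda>j. - simple i j)" by simp
    then show ?thesis using si[of j]
      by (simp add: reflection_eq pairing_uminus pairing_simple[OF i] A_diag[OF i])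
  next
    case 2
    \<comment> \<open>Equality would give \<open>pairing g i \<le> - 1\<close> by
      \<open>pairing_antimono\<close>, against dominance of \<open>g\<close>; hence there is room to
      add 1.\<close>
    have "x i \<noteq> g i" using pairing_antimono[of i x g] le i g_pairing[OF assms(3)] 2 by auto
    then have "x i < g i" using le[of i] by simp
    then show ?thesis using le[of j] ge[of j] 2 by (cases "j = i") (simp_all add: reflection_eq simple_def)
  next
    case 3
    then show ?thesis using le ge by (simp add: reflection_eq)
  next
    case 4
    have "- x j \<le> g j" for j using ge[of j] by simp
    then have "x i \<noteq> - g i"
      using pairing_antimono[of i "\<lambda>j. - x j" g] i g_pairing[OF assms(3)] 4
      by (auto simp: pairing_uminus)
    then have "- g i < x i" using ge[of i] by simp
    then show ?thesis using le[of j] ge[of j] 4 by (cases "j = i") (simp_all add: reflection_eq simple_def)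
  next
    case 5
    then have "(\<lambda>j. - x j) = (\<lambda>j. - simple i j)"
      using assms(2) by (intro short_pairing_le_neg_2[OF sq' _ assms(3)]) (auto simp: pairing_uminus)
    then have "x = simple i" by (simp add: fun_eq_iff)
    then show ?thesis using si[of j]
      by (simp add: reflection_eq pairing_simple[OF i] A_diag[OF i])
  qed
qed

text \<open>The bounds are carried only for squared length \<open>2 * d i0\<close>, where
  \<open>short_between_reflection\<close> applies. That each root has the length of a simple root of
  \<open>L\<close> shows this value to be minimal.\<close>

lemma roots_between:
  assumes "x \<in> roots n A L"
  shows "(\<forall>j. j \<notin> L \<longrightarrow> x j = 0) \<and> (\<exists>k\<in>L. sq x = 2 * d k) \<and>
    (sq x = 2 * d i0 \<longrightarrow> (\<forall>j. x j \<le> g j \<and> - g j \<le> x j))"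
  using assms
proof induction
  case (simple_root i)
  moreover have "simple i j \<le> g j \<and> - g j \<le> simple i j" for j
    using g_pos[OF simple_root] g_nonneg[of j] by (auto simp: simple_def)
  ultimately show ?case using sq_simple[OF L_le] by (auto simp: simple_def)
next
  case (reflected_root x i)
  have "reflection n A i x j = 0" if "j \<notin> L" for j
    using reflected_root that by (auto simp: reflection_eq simple_def)
  then show ?case
    using reflected_root short_between_reflection[of x i]
    by (auto simp: sq_reflection[OF L_le[OF reflected_root(2)]])
qed

text \<open>Take a non-negative root of squared length \<open>2 * d i0\<close> with largest
  coordinate sum. It is dominant, since reflecting at a negative pairing would enlarge it. So it
  lies above \<open>g\<close> by leastness and below \<open>g\<close> by
  \<open>roots_between\<close>.\<close>

lemma g_root: "g \<in> roots n A L" and sq_g: "sq g = 2 * d i0"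
proof -
  define R where "R = {x \<in> roots n A L. sq x = 2 * d i0 \<and> (\<forall>j. 0 \<le> x j)}"
  define N where "N = (\<lambda>x :: nat \<Rightarrow> int. nat (\<Sum>j\<le>n. g j - x j))"
  have "simple i0 \<in> R"
    using roots.simple_root[OF i0] sq_simple[OF L_le[OF i0]] by (simp add: R_def simple_def)
  then obtain x where x: "x \<in> R" and least: "\<And>y. y \<in> R \<Longrightarrow> N x \<le> N y"
    using ex_has_least_nat[of "\<lambda>x. x \<in> R"] by metis
  have xg: "x j \<le> g j" and x_out: "j \<notin> L \<Longrightarrow> x j = 0" for j
    using x roots_between[of x] by (auto simp: R_def)
  have "0 \<le> pairing x i" if i: "i \<in> L" for i
  proof (rule ccontr)
    assume neg: "\<not> ?thesis"
    let ?y = "reflection n A i x"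
    have "0 \<le> x i" using x by (simp add: R_def)
    then have "pairing x i \<le> x i" using neg by linarith
    then have "?y \<in> R"
      using x i neg roots.reflected_root[of x n A L i] sq_reflection[OF L_le[OF i], of x]
      by (auto simp: R_def reflection_eq simple_def)
    moreover from this have "?y j \<le> g j" for j using roots_between[of ?y] by (auto simp: R_def)
    moreover have "(\<Sum>j\<le>n. g j - ?y j) < (\<Sum>j\<le>n. g j - x j)"
      using neg L_le[OF i] by (intro sum_strict_mono_ex1) (auto simp: reflection_eq simple_def)
    moreover from calculation(2) have "0 \<le> (\<Sum>j\<le>n. g j - ?y j)" by (intro sum_nonneg) simp
    ultimately show False using least[of ?y] by (simp add: N_def)
  qed
  moreover have "\<exists>j. x j \<noteq> 0"
  proof (rule ccontr)
    assume "\<not> ?thesis"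
    then have "sq x = 0" by (simp add: sq_length_def)
    then show False using x d_pos[OF L_le[OF i0]] by (simp add: R_def)
  qed
  ultimately have "x \<in> dominant_on L" using x x_out by (simp add: dominant_on_def R_def)
  then have "x = g" using g_least xg by (intro ext antisym) auto
  then show "g \<in> roots n A L" "sq g = 2 * d i0" using x by (auto simp: R_def)
qed

lemma g_highest_short_root: "highest_short_root n A a av L g"
proof -
  have "sq g \<le> sq x" if "x \<in> roots n A L" for x
    using roots_between[OF that] sq_g i0_short by auto
  moreover have "x j \<le> g j" if "x \<in> short_roots n A a av L" for x j
  proof -
    have "x \<in> roots n A L" "sq x \<le> sq g" using that g_root by (auto simp: short_roots_def)
    then show ?thesis using roots_between[of x] sq_g i0_short by force
  qed
  ultimately show ?thesis using g_root by (simp add: highest_short_root_def short_roots_def)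
qed

text \<open>Adding the simple root \<open>j\<close> to \<open>g\<close> gives squared length at most
  \<open>2 * (d i0 - d j)\<close>, so the sum is isotropic and proportional to \<delta>.\<close>

lemma special_vertexI:
  assumes "j \<le> n" "j \<notin> L" "pairing g j \<le> - 2" "d i0 \<le> d j"
  shows "special_vertex n A a av j"
proof -
  have "d j * of_int (pairing g j) \<le> d j * (- 2)"
    using assms(3) d_pos[OF assms(1)] by (intro mult_left_mono) auto
  then have "sq (\<lambda>k. g k + 1 * simple j k) \<le> 0"
    unfolding sq_add_simple[OF assms(1)] using assms(4) sq_g by simp
  then obtain t where t: "\<And>i. i \<le> n \<Longrightarrow> of_int (g i + 1 * simple j i) = t * real (a i)"
    using isotropic by blast
  have tj: "t * real (a j) = 1" using t[OF assms(1)] g_outside[OF assms(2)] by (simp add: simple_def)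
  have ga: "int (a i) = (g i + simple j i) * int (a j)" if "i \<le> n" for i
  proof -
    have "real_of_int ((g i + simple j i) * int (a j)) = t * real (a j) * real (a i)"
      using t[OF that] by simp
    then show ?thesis unfolding tj by linarith
  qed
  \<comment> \<open>The sum has coordinate 1 at \<open>j\<close>, so every label is a multiple of
    \<open>a j\<close>. Coprimality turns proportionality into equality, and positive labels then
    put every other vertex into \<open>L\<close>.\<close>
  then have "a j dvd a i" if "i \<le> n" for i
    using that by (metis dvd_triv_right int_dvd_int_iff)
  then have "a j dvd Gcd (a ` {..n})" by (auto intro: Gcd_greatest)
  then have "a j = 1" using labels by (simp add: numerical_labels_def)
  then have ag: "int (a i) = g i + simple j i" if "i \<le> n" for i using ga[OF that] by simp
  have "i \<in> L" if "i \<le> n" "i \<noteq> j" for i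
    using ag[OF that(1)] a_pos[OF that(1)] that g_outside[of i] by (auto simp: simple_def)
  then have "L = {..n} - {j}" using L_le assms(2) by auto
  then show ?thesis
    using assms(1) L_connected g_highest_short_root ag by (auto simp: special_vertex_def)
qed

end

section \<open>Triple edges\<close>

context affine_diagram
begin

lemma triple_edge_converse:
  assumes "x \<le> n" "y \<le> n" "A x y = - 3" "- 3 \<le> A y x"
  shows "A y x = - 1" "d y = 3 * d x"
proof -
  have ne: "x \<noteq> y" using assms A_diag by auto
  have neg: "A y x \<le> - 1" using A_zero_sym[OF assms(1,2)] A_le_0[of y x] assms ne by force
  have dd: "d x * (- 3) = d y * of_int (A y x)" using dA_sym[OF assms(1,2)] assms(3) by simp
  have dx: "0 < d x" using d_pos assms by simp
  \<comment> \<open>Non-negativity at this vector bounds \<open>d y / d x\<close> below by 9/4,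
    whereas \<open>A y x \<le> - 2\<close> would bound it above by 3/2.\<close>
  let ?v = "\<lambda>j. (0 + 3 * simple x j) + 2 * simple y j"
  have "sq ?v = 18 * d x + 4 * d y * of_int (3 * A y x) + 8 * d y"
    unfolding sq_add_simple[OF assms(2)] sq_add_simple[OF assms(1)] pairing_add_simple[OF assms(1)]
    by (simp add: sq_length_def pairing_def)
  then have "sq ?v = - 18 * d x + 8 * d y" using dd by simp
  then have ge: "18 * d x \<le> 8 * d y" using sq_nonneg[of ?v] by simp
  show yx: "A y x = - 1"
  proof (rule ccontr)
    assume "A y x \<noteq> - 1"
    then have "of_int (A y x) \<le> (- 2 :: real)" using neg by linarith
    then have "d y * of_int (A y x) \<le> d y * (- 2)"
      using d_pos[OF assms(2)] by (intro mult_left_mono) auto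
    then show False using dd ge dx by linarith
  qed
  show "d y = 3 * d x" using dd yx by simp
qed

text \<open>The vector \<open>w\<close> is as long as the simple root \<open>e\<close> but pairs
  with \<open>z\<close> at least twice as negatively, so adding the simple root \<open>z\<close>
  gives squared length at most 0, and below 0 if \<open>d z < d e\<close>. Hence \<open>z\<close> is
  not \<open>j\<close>, and the sum is isotropic, zero at \<open>j\<close> and nonzero at
  \<open>z\<close>, which is impossible.\<close>

lemma no_isotropic_extension:
  assumes "e \<le> n" "z \<le> n" "e \<noteq> z" "A e z \<noteq> 0" "sq w = 2 * d e" "pairing w z \<le> 2 * A z e" "w z = 0"
    and j: "j \<le> n" "w j = 0" "e \<noteq> j" "\<And>i. i \<le> n \<Longrightarrow> i \<noteq> j \<Longrightarrow> d j < d i"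
  shows False
proof -
  let ?v = "\<lambda>k. w k + 1 * simple z k"
  have neg: "A e z \<le> - 1" "A z e \<le> - 1"
    using A_zero_sym[OF assms(1,2)] A_le_0[of e z] A_le_0[of z e] assms by force+
  have "d z * of_int (pairing w z) \<le> d z * of_int (2 * A z e)"
    using assms(6) d_pos[OF assms(2)] by (intro mult_left_mono) auto
  moreover have "d z * of_int (A z e) \<le> d z * (- 1)"
    using neg d_pos[OF assms(2)] by (intro mult_left_mono) auto
  moreover have "d z * of_int (A z e) \<le> d e * (- 1)"
    unfolding dA_sym[OF assms(2,1)] using neg d_pos[OF assms(1)] by (intro mult_left_mono) auto
  ultimately have le: "sq ?v \<le> 0" and less: "d z < d e \<Longrightarrow> sq ?v < 0"
    unfolding sq_add_simple[OF assms(2)] using assms(5) by auto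
  then have "z \<noteq> j" using j(3,4) assms(1) sq_nonneg[of ?v] by fastforce
  obtain t where t: "\<And>i. i \<le> n \<Longrightarrow> of_int (?v i) = t * real (a i)"
    using isotropic[OF le] by blast
  have "t = 0" using t[OF j(1)] a_pos[OF j(1)] j(2) \<open>z \<noteq> j\<close> by (simp add: simple_def)
  then show False using t[OF assms(2)] assms(7) by (simp add: simple_def)
qed

lemma triple_edge_short_vertex:
  assumes "x \<le> n" "y \<le> n" "A x y = - 3" "- 3 \<le> A y x"
    and j: "j \<le> n" "\<And>i. i \<le> n \<Longrightarrow> i \<noteq> j \<Longrightarrow> d j < d i"
  shows "j = x"
proof (rule ccontr)
  assume "j \<noteq> x"
  note xy = triple_edge_converse[OF assms(1-4)]
  have ne: "x \<noteq> y" using assms A_diag by auto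
  have "j \<noteq> y" using j(2)[OF assms(1)] \<open>j \<noteq> x\<close> xy(2) d_pos[OF assms(1)] by auto
  obtain e z where e: "e \<in> {x, y}" and z: "z \<in> {..n}" "z \<notin> {x, y}" "A e z \<noteq> 0"
    by (rule connected_diagram_neighbour[OF connected, of "{x, y}"])
      (use assms \<open>j \<noteq> x\<close> \<open>j \<noteq> y\<close> in auto)
  have Az: "A z x \<le> 0" "A z y \<le> 0" using A_le_0 z assms by auto
  \<comment> \<open>Coefficients (2, 1) and (3, 2) give the highest short root and the highest root
    of the \<open>G_2\<close> subdiagram. They have the lengths of the simple roots \<open>x\<close>
    and \<open>y\<close> and contain these with coefficient 2, as
    \<open>no_isotropic_extension\<close> demands.\<close>
  let ?w = "\<lambda>p q k. (0 + p * simple x k) + q * simple y k"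
  have sq_w: "sq (?w p q) = (2 * p\<^sup>2 + 6 * q\<^sup>2 - 6 * p * q) * d x" for p q
    unfolding sq_add_simple[OF assms(2)] sq_add_simple[OF assms(1)] pairing_add_simple[OF assms(1)]
    using xy by (simp add: sq_length_def pairing_def algebra_simps)
  have pairing_w: "pairing (?w p q) z = p * A z x + q * A z y" for p q
    unfolding pairing_add_simple[OF assms(2)] pairing_add_simple[OF assms(1)]
    by (simp add: pairing_def)
  have w0: "?w p q z = 0" "?w p q j = 0" for p q
    using z \<open>j \<noteq> x\<close> \<open>j \<noteq> y\<close> by (auto simp: simple_def)
  show False
  proof (cases "e = x")
    case True
    have sq: "sq (?w 2 1) = 2 * d x" unfolding sq_w by simp
    have p: "pairing (?w 2 1) z \<le> 2 * A z x" unfolding pairing_w using Az by simp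
    show False
      by (rule no_isotropic_extension[OF assms(1) _ _ _ sq p w0(1) j(1) w0(2) _ j(2)])
        (use z True \<open>j \<noteq> x\<close> in auto)
  next
    case False
    have sq: "sq (?w 3 2) = 2 * d y" unfolding sq_w using xy by simp
    have p: "pairing (?w 3 2) z \<le> 2 * A z y" unfolding pairing_w using Az by simp
    show False
      by (rule no_isotropic_extension[OF assms(2) _ _ _ sq p w0(1) j(1) w0(2) _ j(2)])
        (use e z False \<open>j \<noteq> y\<close> in auto)
  qed
qed

end

section \<open>Covering relations\<close>

text \<open>The covering relation in coordinates, with \<open>c i\<close> the value of \<mu> on
  coroot \<open>i\<close>: \<open>pairing \<beta> i \<le> int (c i)\<close> says that \<mu> -
  \<beta> is dominant, and then a nonzero \<beta> between 0 and \<delta> must be \<delta>.\<close>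

locale covered_weight = affine_diagram +
  fixes c :: "nat \<Rightarrow> nat"
  assumes c_nonzero: "\<exists>i\<le>n. c i \<noteq> 0"
    and covering: "(\<And>j. j \<le> n \<Longrightarrow> 0 \<le> \<beta> j \<and> \<beta> j \<le> int (a j)) \<Longrightarrow> k \<le> n \<Longrightarrow> \<beta> k \<noteq> 0 \<Longrightarrow>
      (\<And>i. i \<le> n \<Longrightarrow> pairing \<beta> i \<le> int (c i)) \<Longrightarrow> j \<le> n \<Longrightarrow> \<beta> j = int (a j)"
begin

lemma n_pos: "0 < n"
proof (rule ccontr)
  assume "\<not> ?thesis"
  moreover have "(\<Sum>k\<le>n. A 0 k * int (a k)) = 0"
    using pairing_labels[of 0] unfolding pairing_def by simp
  ultimately show False using A_diag[of 0] a_pos[of 0] by simp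
qed

lemma c_le_1: assumes "i \<le> n" shows "c i \<le> 1"
proof (rule ccontr)
  assume "\<not> ?thesis"
  then have "pairing (simple i) p \<le> int (c p)" if "p \<le> n" for p
    using A_diag[OF assms] A_le_0[OF that assms] unfolding pairing_simple[OF assms]
    by (cases "p = i") auto
  then have eq: "simple i j = int (a j)" if "j \<le> n" for j
    using a_pos assms that by (intro covering[where k = i]) (auto simp: simple_def Suc_leI)
  have "\<exists>j\<le>n. j \<noteq> i" using n_pos by (metis le0 order_refl less_irrefl)
  then show False using eq a_pos by (force simp: simple_def)
qed

lemma two_supports:
  assumes "t \<le> n" "t' \<le> n" "t \<noteq> t'" "c t \<noteq> 0" "c t' \<noteq> 0"
  obtains \<sigma> where "numbering n A (if n = 1 then mat_A1_1 else mat_D_2 n) \<sigma>"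
    "\<And>i. i \<le> n \<Longrightarrow> c (\<sigma> i) = (if i = 0 \<or> i = n then 1 else 0)"
proof -
  define R where "R = {(p, q). p \<in> {..n} \<and> q \<in> {..n} \<and> p \<noteq> q \<and> A p q \<noteq> 0}"
  define Q where "Q = (\<lambda>k. \<exists>u v. u \<le> n \<and> v \<le> n \<and> u \<noteq> v \<and> c u \<noteq> 0 \<and> c v \<noteq> 0 \<and> (u, v) \<in> R ^^ k)"
  have "(t, t') \<in> R\<^sup>*"
    using connected assms(1,2) unfolding connected_diagram_def R_def by blast
  then have "\<exists>k. Q k" using assms unfolding Q_def by (metis rtrancl_imp_relpow)
  then obtain k where "Q k" and least: "\<And>k'. Q k' \<Longrightarrow> k \<le> k'"
    by (metis LeastI_ex Least_le)
  then obtain u v where uv: "u \<le> n" "v \<le> n" "u \<noteq> v" "c u \<noteq> 0" "c v \<noteq> 0" "(u, v) \<in> R ^^ k"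
    by (auto simp: Q_def)
  then obtain \<sigma> where \<sigma>: "\<sigma> 0 = u" "\<sigma> k = v" "\<And>i. i < k \<Longrightarrow> (\<sigma> i, \<sigma> (Suc i)) \<in> R"
    unfolding relpow_fun_conv by blast
  have k: "0 < k" using uv(3) \<sigma>(1,2) by (auto intro!: gr0I)
  have le: "\<sigma> i \<le> n" if "i \<le> k" for i
    using \<sigma>(2) \<sigma>(3)[of i] uv(2) that by (cases "i = k") (auto simp: R_def)
  have seg: "(\<sigma> i, \<sigma> j) \<in> R ^^ (j - i)" if "i \<le> j" "j \<le> k" for i j
    unfolding relpow_fun_conv using that \<sigma>(3) by (intro exI[of _ "\<lambda>m. \<sigma> (i + m)"]) auto
  \<comment> \<open>A walk of length \<open>m\<close> may replace the stretch from
    \<open>\<sigma> i\<close> to \<open>\<sigma> j\<close>. Taking \<open>m = 0\<close> makes the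
    vertices distinct, and \<open>m = 1\<close> excludes chords.\<close>
  have short: "k \<le> i + (m + (k - j))" if "i \<le> k" "j \<le> k" "(\<sigma> i, \<sigma> j) \<in> R ^^ m" for i j m
  proof -
    have "(u, v) \<in> R ^^ (i + (m + (k - j)))"
      using seg[of 0 i] seg[of j k] that unfolding relpow_add \<sigma>(1,2) by auto
    then show ?thesis using uv by (intro least) (auto simp: Q_def)
  qed
  have ne: "\<sigma> i \<noteq> \<sigma> j" if "i < j" "j \<le> k" for i j
    using short[of i j 0] that by auto
  have inj: "inj_on \<sigma> {..k}"
    using ne by (intro linorder_inj_onI) auto
  have nonadj: "A (\<sigma> i) (\<sigma> j) = 0" if "Suc i < j" "j \<le> k" for i j
    using short[of i j 1] ne[of i j] le[of i] le[of j] that by (force simp: R_def)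
  have nonadj': "A (\<sigma> j) (\<sigma> i) = 0" if "Suc i < j" "j \<le> k" for i j
    using nonadj[OF that] A_zero_sym[OF le le, of i j] that by auto
  have adj: "A (\<sigma> i) (\<sigma> (Suc i)) \<le> - 1" "A (\<sigma> (Suc i)) (\<sigma> i) \<le> - 1" if "i < k" for i
    using \<sigma>(3)[OF that] A_zero_sym[of "\<sigma> i" "\<sigma> (Suc i)"] A_le_0[of "\<sigma> i" "\<sigma> (Suc i)"]
      A_le_0[of "\<sigma> (Suc i)" "\<sigma> i"] by (force simp: R_def)+
  have adj': "A (\<sigma> i) (\<sigma> (i - 1)) \<le> - 1" if "0 < i" "i \<le> k" for i
    using adj(2)[of "i - 1"] that by simp
  have inner: "c (\<sigma> i) = 0" if "0 < i" "i < k" for i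
  proof (rule ccontr)
    assume "c (\<sigma> i) \<noteq> 0"
    then have "Q i" using seg[of 0 i] that uv \<sigma>(1) le[of i] ne[of 0 i] by (force simp: Q_def)
    then show False using least that by fastforce
  qed
  define \<beta> :: "nat \<Rightarrow> int" where "\<beta> = (\<lambda>j. if j \<in> \<sigma> ` {..k} then 1 else 0)"
  have pairing_\<beta>: "pairing \<beta> p = (\<Sum>i\<le>k. A p (\<sigma> i))" for p
  proof -
    have "pairing \<beta> p = (\<Sum>q\<in>\<sigma> ` {..k}. A p q)"
      unfolding pairing_def \<beta>_def using le by (intro sum.mono_neutral_cong_right) auto
    then show ?thesis by (simp add: sum.reindex[OF inj])
  qed
  have row: "pairing \<beta> (\<sigma> i) = 2 + (if i < k then A (\<sigma> i) (\<sigma> (Suc i)) else 0) +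
      (if 0 < i then A (\<sigma> i) (\<sigma> (i - 1)) else 0)" if "i \<le> k" for i
  proof -
    \<comment> \<open>For \<open>i = 0\<close> the natural number \<open>i - 1\<close> is again 0,
      hence the inner guard \<open>0 < i\<close>.\<close>
    have "A (\<sigma> i) (\<sigma> j) = (if j = i then 2 else 0) +
        (if j = Suc i then A (\<sigma> i) (\<sigma> (Suc i)) else 0) +
        (if j = i - 1 then if 0 < i then A (\<sigma> i) (\<sigma> (i - 1)) else 0 else 0)" if "j \<le> k" for j
      using A_diag[OF le[OF \<open>i \<le> k\<close>]] nonadj[of i j] nonadj'[of j i] \<open>i \<le> k\<close> that
      by (cases "Suc i < j"; cases "Suc j < i") (auto split: if_splits)
    then have "pairing \<beta> (\<sigma> i) = (\<Sum>j\<le>k. (if j = i then 2 else 0) +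
        (if j = Suc i then A (\<sigma> i) (\<sigma> (Suc i)) else 0) +
        (if j = i - 1 then if 0 < i then A (\<sigma> i) (\<sigma> (i - 1)) else 0 else 0))"
      unfolding pairing_\<beta> by (intro sum.cong) auto
    moreover have "i - 1 \<le> k" using that by simp
    ultimately show ?thesis using that by (simp add: sum.distrib Suc_le_eq)
  qed
  \<comment> \<open>Two neighbours bring an inner vertex down to at most 0; one neighbour leaves at
    most 1 at an end, where \<open>c\<close> is positive.\<close>
  have bound: "pairing \<beta> p \<le> int (c p)" if "p \<le> n" for p
  proof (cases "p \<in> \<sigma> ` {..k}")
    case True
    then obtain i where i: "i \<le> k" "p = \<sigma> i" by auto
    show ?thesis
      using row[OF i(1)] adj(1)[of i] adj'[of i] uv(4,5) \<sigma>(1,2) i k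
      by (cases "i = 0"; cases "i = k") auto
  next
    case False
    then have "pairing \<beta> p \<le> 0"
      unfolding pairing_\<beta> using A_le_0[OF that le] by (intro sum_nonpos) auto
    then show ?thesis by simp
  qed
  have \<beta>_eq: "\<beta> j = int (a j)" if "j \<le> n" for j
    by (rule covering[of \<beta> u]) (use bound that uv(1) \<sigma>(1) a_pos in \<open>auto simp: \<beta>_def Suc_leI\<close>)
  then have "{..n} \<subseteq> \<sigma> ` {..k}"
    using a_pos by (force simp: \<beta>_def split: if_splits)
  then have img: "\<sigma> ` {..k} = {..n}" using le by auto
  then have kn: "k = n" using card_image[OF inj] by simp
  have bij: "bij_betw \<sigma> {..n} {..n}" using inj img kn by (simp add: bij_betw_def)
  have zero: "pairing \<beta> (\<sigma> i) = 0" if "i \<le> n" for i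
  proof -
    have "pairing \<beta> (\<sigma> i) = pairing (\<lambda>j. int (a j)) (\<sigma> i)"
      unfolding pairing_def using \<beta>_eq by (intro sum.cong) auto
    then show ?thesis using pairing_labels[OF le] that kn by simp
  qed
  have diag: "A (\<sigma> i) (\<sigma> i) = 2" if "i \<le> n" for i using A_diag[OF le] that kn by simp
  \<comment> \<open>With all labels 1 the rows sum to zero: the end entries are -2, and two inner
    entries, each at most -1, are both -1.\<close>
  have first: "A (\<sigma> 0) (\<sigma> (Suc 0)) = - 2"
    using row[of 0] zero[of 0] k kn by simp
  have final: "A (\<sigma> n) (\<sigma> (n - 1)) = - 2"
    using row[of n] zero[of n] k kn by simp
  have up: "A (\<sigma> i) (\<sigma> (Suc i)) = - 1" and down: "A (\<sigma> i) (\<sigma> (i - 1)) = - 1"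
    if "0 < i" "i < n" for i
    using row[of i] zero[of i] adj(1)[of i] adj'[of i] that kn by auto
  have "A (\<sigma> i) (\<sigma> j) = (if n = 1 then mat_A1_1 else mat_D_2 n) i j" if ij: "i \<le> n" "j \<le> n" for i j
  proof -
    consider "i = j" | "Suc i < j" | "Suc j < i" | "j = Suc i" | "i = Suc j" by linarith
    then show ?thesis
    proof cases
      case 1
      then show ?thesis using diag ij by (simp add: mat_A1_1_def mat_D_2_def)
    next
      case 2
      then show ?thesis using nonadj[of i j] ij kn by (auto simp: mat_A1_1_def mat_D_2_def)
    next
      case 3
      then show ?thesis using nonadj'[of j i] ij kn by (auto simp: mat_A1_1_def mat_D_2_def)
    next
      case 4
      then show ?thesis using first up[of i] ij by (cases "i = 0") (auto simp: mat_A1_1_def mat_D_2_def)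
    next
      case 5
      then show ?thesis using final down[of i] ij
        by (cases "i = n") (auto simp: mat_A1_1_def mat_D_2_def)
    qed
  qed
  then have "numbering n A (if n = 1 then mat_A1_1 else mat_D_2 n) \<sigma>"
    using bij by (simp add: numbering_def)
  moreover have "c (\<sigma> i) = (if i = 0 \<or> i = n then 1 else 0)" if "i \<le> n" for i
    using that inner[of i] c_le_1[OF uv(1)] c_le_1[OF uv(2)] uv(4,5) \<sigma>(1,2) kn by auto
  ultimately show ?thesis using that by blast
qed

text \<open>\<open>L\<close> is the component containing the given \<open>i\<close>; letting
  \<open>i\<close> vary over all components makes \<open>j\<close> strictly shortest unless it is
  special.\<close>

lemma single_support:
  assumes j: "j \<le> n" "c j = 1" "\<And>i. i \<le> n \<Longrightarrow> i \<noteq> j \<Longrightarrow> c i = 0"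
    and i: "i \<le> n" "i \<noteq> j"
  shows "special_vertex n A a av j \<or> d j < d i"
proof -
  obtain L where L: "L \<subseteq> {..n} - {j}" "i \<in> L" "connected_diagram A L"
      "\<And>v k. v \<in> {..n} - {j} - L \<Longrightarrow> k \<in> L \<Longrightarrow> A v k = 0"
    by (rule connected_component_exists[of "{..n} - {j}" i A])
      (use i A_zero_sym in auto)
  have Ln: "L \<subseteq> {..n}" using L(1) by auto
  obtain g where g: "g \<in> dominant_on L" "\<And>x j. x \<in> dominant_on L \<Longrightarrow> g j \<le> x j"
    using least_dominant_exists[OF L(3) Ln] by blast
  have "finite L" using Ln finite_subset by blast
  then obtain i0 where i0: "i0 \<in> L" "\<And>k. k \<in> L \<Longrightarrow> d i0 \<le> d k"
    using L(2) arg_min_least[of L _ d] arg_min_if_finite(1)[of L d] by blast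
  interpret finite_subdiagram n A a av L g i0
    using L j g i0 by unfold_locales auto
  let ?\<beta> = "\<lambda>k. int (a k) - g k"
  have pairing_\<beta>: "pairing ?\<beta> p = - pairing g p" if "p \<le> n" for p
    using pairing_labels[OF that] by (simp add: pairing_diff)
  have "j \<notin> L" using L(1) by auto
  \<comment> \<open>Otherwise \<open>covering\<close> would give \<delta> - \<open>g\<close> =
    \<delta>, although \<open>g\<close> is positive on \<open>L\<close>.\<close>
  have "\<exists>p\<le>n. int (c p) < pairing ?\<beta> p"
  proof (rule ccontr)
    assume no: "\<not> ?thesis"
    have "?\<beta> i = int (a i)"
      by (rule covering[of _ j])
        (use no i(1) j(1) g_nonneg g_le_labels g_outside \<open>j \<notin> L\<close> a_pos[OF j(1)] in
          \<open>force simp: not_less\<close>)+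
    then show False using g_pos[OF L(2)] by simp
  qed
  then obtain p where p: "p \<le> n" "int (c p) < - pairing g p" using pairing_\<beta> by auto
  \<comment> \<open>Dominance of \<open>g\<close> excludes \<open>p\<close> in \<open>L\<close>, and
    a vertex outside \<open>L\<close> other than \<open>j\<close> has no neighbour in
    \<open>L\<close>.\<close>
  have "p = j"
  proof (rule ccontr)
    assume "p \<noteq> j"
    moreover have "p \<notin> L" using g_pairing[of p] p(2) by auto
    ultimately have "A p k * g k = 0" for k
      using L(4)[of p k] g_outside[of k] p(1) by (cases "k \<in> L") auto
    then have "pairing g p = 0" unfolding pairing_def by (simp only: sum.neutral_const)
    then show False using p(2) by simp
  qed
  then have pair: "pairing g j \<le> - 2" using p(2) j(2) by simp
  show ?thesis
  proof (cases "d i0 \<le> d j")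
    case True
    then show ?thesis using special_vertexI[OF j(1) \<open>j \<notin> L\<close> pair] by simp
  next
    case False
    then show ?thesis using i0_short[OF L(2)] by simp
  qed
qed

lemma triple_edge_short_end:
  assumes "x \<le> n" "y \<le> n" "A x y = - 3" "- 3 \<le> A y x"
  shows "c x = 0"
proof (rule ccontr)
  assume "c x \<noteq> 0"
  have ne: "x \<noteq> y" using assms A_diag by auto
  note xy = triple_edge_converse[OF assms]
  let ?w = "\<lambda>p q k. (0 + p * simple x k) + q * simple y k"
  have pairing_w: "pairing (?w p q) z = p * A z x + q * A z y" for p q z
    unfolding pairing_add_simple[OF assms(2)] pairing_add_simple[OF assms(1)]
    by (simp add: pairing_def)
  \<comment> \<open>Cutting \<delta> down to \<open>x\<close> and \<open>y\<close> gives
    \<open>0 \<le> 2 * a x - 3 * a y\<close>, so the coefficients (2, 1) lie below \<delta>.\<close>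
  have "pairing (\<lambda>k. int (a k)) x \<le> pairing (?w (int (a x)) (int (a y))) x"
    using assms(1) ne by (intro pairing_antimono) (auto simp: simple_def)
  then have "3 * a y \<le> 2 * a x"
    unfolding pairing_w using pairing_labels[OF assms(1)] A_diag[OF assms(1)] assms(3) by simp
  then have a: "2 \<le> a x" "1 \<le> a y" using a_pos[OF assms(2)] by auto
  \<comment> \<open>The values are 1 at \<open>x\<close>, 0 at \<open>y\<close> and non-positive
    elsewhere. So \<open>covering\<close> forces \<delta>, whose value at \<open>x\<close> is
    0.\<close>
  have "pairing (?w 2 1) z \<le> int (c z)" if "z \<le> n" for z
    unfolding pairing_w
    using A_le_0[OF that assms(1)] A_le_0[OF that assms(2)] A_diag[OF that] assms(3) xy \<open>c x \<noteq> 0\<close>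
    by (cases "z = x"; cases "z = y") auto
  then have "?w 2 1 k = int (a k)" if "k \<le> n" for k
    using a assms(1) that ne by (intro covering[of "?w 2 1" x]) (auto simp: simple_def)
  then have "pairing (?w 2 1) x = pairing (\<lambda>k. int (a k)) x"
    unfolding pairing_def by (intro sum.cong) auto
  then show False
    unfolding pairing_w using pairing_labels[OF assms(1)] A_diag[OF assms(1)] assms(3) by simp
qed

lemma not_triply_laced:
  assumes j: "j \<le> n" "c j \<noteq> 0" "\<And>i. i \<le> n \<Longrightarrow> i \<noteq> j \<Longrightarrow> d j < d i"
  shows "\<not> triply_laced n A"
proof
  have *: False if "x \<le> n" "y \<le> n" "A x y = - 3" "- 3 \<le> A y x" for x y
    using triple_edge_short_vertex[OF that j(1,3)] triple_edge_short_end[OF that] j(2) by simp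
  assume "triply_laced n A"
  then obtain x y where xy: "x \<le> n" "y \<le> n" "x \<noteq> y" "max \<bar>A x y\<bar> \<bar>A y x\<bar> = 3"
    by (auto simp: triply_laced_def)
  then have "A x y \<le> 0" "A y x \<le> 0" using A_le_0 by auto
  then show False using *[of x y] *[of y x] xy by (auto simp: max_def split: if_splits)
qed

end

section \<open>Weights on the Cartan subalgebra\<close>

lemma realization_vector_space_pair:
  assumes "realization n A scale \<alpha> h"
  shows "vector_space_pair scale ((*) :: complex \<Rightarrow> complex \<Rightarrow> complex)"
  using assms
  by (auto simp: realization_def vector_space_pair_def algebra_simps intro!: vector_space.intro)

lemma dual_space_subtract_roots:
  assumes real: "realization n A scale \<alpha> h" and "\<mu> \<in> dual_space scale"
  shows "(\<lambda>x. \<mu> x - (\<Sum>k\<le>n. of_int (\<beta> k) * \<alpha> k x)) \<in> dual_space scale"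
proof -
  interpret vector_space_pair scale "(*) :: complex \<Rightarrow> _"
    by (rule realization_vector_space_pair[OF real])
  have "Vector_Spaces.linear scale (*) (\<lambda>x. of_int (\<beta> k) * \<alpha> k x)" if "k \<le> n" for k
    using real that linear_compose_scale_right[of "\<alpha> k" "of_int (\<beta> k)"]
    by (simp add: realization_def dual_space_def)
  then show ?thesis
    using assms(2) by (auto simp: dual_space_def intro!: linear_compose_sub linear_compose_sum)
qed

lemma fundamental_weight_exists:
  assumes real: "realization n A scale \<alpha> h" and "i \<le> n"
  obtains \<omega> where "fundamental_weight n scale h i \<omega>"
proof -
  interpret vector_space_pair scale "(*) :: complex \<Rightarrow> _"
    by (rule realization_vector_space_pair[OF real])
  have inj: "inj_on h {..n}" and "\<not> vs1.dependent (h ` {..n})"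
    using real by (auto simp: realization_def)
  then obtain \<omega> where "Vector_Spaces.linear scale (*) \<omega>" "\<forall>x\<in>h ` {..n}. \<omega> x = (if x = h i then 1 else 0)"
    using linear_independent_extend[of "h ` {..n}" "\<lambda>x. if x = h i then 1 else 0"] by blast
  then have "fundamental_weight n scale h i \<omega>"
    using assms(2) inj_on_eq_iff[OF inj] by (auto simp: fundamental_weight_def dual_space_def)
  then show ?thesis using that by blast
qed

text \<open>Since fundamental weights are determined only up to multiples of \<delta>, the second is
  taken to be \<mu> - \<omega>, which makes the decomposition exact.\<close>

lemma split_fundamental_weights:
  assumes real: "realization n A scale \<alpha> h" and "\<mu> \<in> dual_space scale" "i \<le> n" "j \<le> n" "i \<noteq> j"
    and \<mu>: "\<And>k. k \<le> n \<Longrightarrow> \<mu> (h k) = (if k = i \<or> k = j then 1 else 0)"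
  obtains \<omega> \<omega>' where "fundamental_weight n scale h i \<omega>" "fundamental_weight n scale h j \<omega>'"
    "\<mu> = (\<lambda>x. \<omega> x + \<omega>' x)"
proof -
  interpret vector_space_pair scale "(*) :: complex \<Rightarrow> _"
    by (rule realization_vector_space_pair[OF real])
  obtain \<omega> where \<omega>: "fundamental_weight n scale h i \<omega>"
    using fundamental_weight_exists[OF real assms(3)] by blast
  then have "(\<lambda>x. \<mu> x - \<omega> x) \<in> dual_space scale"
    using assms(2) by (auto simp: fundamental_weight_def dual_space_def intro!: linear_compose_sub)
  then have "fundamental_weight n scale h j (\<lambda>x. \<mu> x - \<omega> x)"
    using \<omega> \<mu> assms(5) by (auto simp: fundamental_weight_def)
  then show ?thesis using that[OF \<omega>] by simp
qed

text \<open>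
  Subtracting from \<open>\<mu>\<close> a vector strictly between \<open>0\<close> and \<open>\<delta>\<close> in the root lattice gives an element
  strictly between \<open>\<mu> - \<delta>\<close> and \<open>\<mu>\<close>, which therefore cannot be dominant.
\<close>

lemma (in affine_diagram) covering_imp_covered_weight:
  assumes real: "realization n A scale \<alpha> h" and "m > 0"
    and cov: "covers_in (dominant_weights_of_level n scale av h m) (weight_le n \<alpha>)
           \<mu> (\<lambda>x. \<mu> x - delta n a \<alpha> x)"
  obtains c where "covered_weight n A a av c" "\<And>i. i \<le> n \<Longrightarrow> \<mu> (h i) = of_nat (c i)"
proof -
  interpret vector_space_pair scale "(*) :: complex \<Rightarrow> _"
    by (rule realization_vector_space_pair[OF real])
  let ?P = "dominant_weights_of_level n scale av h m"
  have \<mu>: "\<mu> \<in> ?P" using cov by (simp add: covers_in_def)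
  then have lin: "\<mu> \<in> dual_space scale"
    by (simp add: dominant_weights_of_level_def dominant_weights_def)
  have "\<forall>i\<le>n. \<exists>k::nat. \<mu> (h i) = of_nat k"
    using \<mu> by (simp add: dominant_weights_of_level_def dominant_weights_def)
  then obtain c where c: "\<And>i. i \<le> n \<Longrightarrow> \<mu> (h i) = of_nat (c i)" by metis
  have level: "f (canonical_central n scale av h) = (\<Sum>i\<le>n. of_nat (av i) * f (h i))"
    if "f \<in> dual_space scale" for f
  proof -
    interpret f: Vector_Spaces.linear scale "(*)" f using that by (simp add: dual_space_def)
    show ?thesis by (simp add: canonical_central_def f.sum f.scale)
  qed
  have indep: "t i = 0" if "\<And>x. (\<Sum>i\<le>n. t i * \<alpha> i x) = 0" "i \<le> n" for t i
    using real that by (simp add: realization_def)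
  have \<alpha>h: "\<alpha> k (h i) = of_int (A i k)" if "i \<le> n" "k \<le> n" for i k
    using real that by (simp add: realization_def)
  \<comment> \<open>The positive level \<open>m\<close> is the sum of the products
    \<open>av i * c i\<close>.\<close>
  have "\<exists>i\<le>n. c i \<noteq> 0"
  proof (rule ccontr)
    assume "\<not> ?thesis"
    then have "\<mu> (canonical_central n scale av h) = 0" by (simp add: level[OF lin] c)
    then show False using \<mu> \<open>m > 0\<close> by (simp add: dominant_weights_of_level_def)
  qed
  moreover have "\<beta> j = int (a j)"
    if \<beta>: "\<And>j. j \<le> n \<Longrightarrow> 0 \<le> \<beta> j \<and> \<beta> j \<le> int (a j)" and k: "k \<le> n" "\<beta> k \<noteq> 0"
      and le: "\<And>i. i \<le> n \<Longrightarrow> pairing \<beta> i \<le> int (c i)" and j: "j \<le> n" for \<beta> j k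
  proof (rule ccontr)
    assume neq: "\<beta> j \<noteq> int (a j)"
    define z where "z = (\<lambda>x. \<mu> x - (\<Sum>k\<le>n. of_int (\<beta> k) * \<alpha> k x))"
    have z: "z \<in> dual_space scale"
      unfolding z_def by (rule dual_space_subtract_roots[OF real lin])
    have zh: "z (h i) = of_int (int (c i) - pairing \<beta> i)" if "i \<le> n" for i
      using that by (simp add: z_def c \<alpha>h pairing_def mult.commute)
    have "\<exists>l::nat. z (h i) = of_nat l" if "i \<le> n" for i
      using le[OF that] zh[OF that] by (intro exI[of _ "nat (int (c i) - pairing \<beta> i)"]) simp
    moreover have "z (canonical_central n scale av h) = of_int m"
    proof -
      \<comment> \<open>Simple roots vanish on the central element because \<open>av\<close>
        annihilates the columns of \<open>A\<close>; subtracting \<beta> thus keeps the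
        level.\<close>
      have "(\<Sum>i\<le>n. int (av i) * pairing \<beta> i) = (\<Sum>k\<le>n. (\<Sum>i\<le>n. A i k * int (av i)) * \<beta> k)"
        unfolding pairing_def sum_distrib_left sum_distrib_right
        by (subst sum.swap) (simp add: mult_ac)
      also have "\<dots> = 0"
        using colabels by (intro sum.neutral) (simp add: numerical_labels_def transposed_def)
      finally have *: "(\<Sum>i\<le>n. int (av i) * pairing \<beta> i) = 0" .
      have "z (canonical_central n scale av h) =
          (\<Sum>i\<le>n. of_nat (av i) * \<mu> (h i)) - of_int (\<Sum>i\<le>n. int (av i) * pairing \<beta> i)"
        unfolding level[OF z] by (simp add: zh c right_diff_distrib sum_subtractf)
      then show ?thesis
        using \<mu> unfolding * level[OF lin, symmetric] by (simp add: dominant_weights_of_level_def)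
    qed
    ultimately have zP: "z \<in> ?P"
      using z by (simp add: dominant_weights_of_level_def dominant_weights_def)
    have z\<mu>: "\<mu> x - z x = (\<Sum>k\<le>n. of_int (\<beta> k) * \<alpha> k x)" for x by (simp add: z_def)
    have z\<delta>: "z x - (\<mu> x - delta n a \<alpha> x) = (\<Sum>k\<le>n. of_int (int (a k) - \<beta> k) * \<alpha> k x)" for x
      by (simp add: z_def delta_def left_diff_distrib sum_subtractf)
    have "weight_le n \<alpha> z \<mu>"
      unfolding weight_le_def z\<mu> using \<beta> by (intro exI[of _ "\<lambda>k. nat (\<beta> k)"]) auto
    moreover have "weight_le n \<alpha> (\<lambda>x. \<mu> x - delta n a \<alpha> x) z"
      unfolding weight_le_def z\<delta> using \<beta>
      by (intro exI[of _ "\<lambda>k. nat (int (a k) - \<beta> k)"] allI sum.cong) auto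
    moreover have "z \<noteq> \<mu>"
      using indep[of "\<lambda>k. of_int (\<beta> k)" k] z\<mu> k by auto
    moreover have "z \<noteq> (\<lambda>x. \<mu> x - delta n a \<alpha> x)"
    proof
      assume "z = (\<lambda>x. \<mu> x - delta n a \<alpha> x)"
      then have "of_int (int (a j) - \<beta> j) = (0 :: complex)"
        using z\<delta> by (intro indep[of "\<lambda>k. of_int (int (a k) - \<beta> k)"] j) auto
      then have "int (a j) - \<beta> j = 0" by (simp only: of_int_eq_0_iff)
      then show False using neq by simp
    qed
    ultimately show False using cov zP unfolding covers_in_def by metis
  qed
  ultimately have "covered_weight n A a av c" by unfold_locales auto
  then show ?thesis using that c by blast
qed

theorem lemma8:
  fixes n :: nat
    and A :: "nat \<Rightarrow> nat \<Rightarrow> int"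
    and a av :: "nat \<Rightarrow> nat"
    and scale :: "complex \<Rightarrow> 'h \<Rightarrow> 'h::ab_group_add"
    and \<alpha> :: "nat \<Rightarrow> 'h \<Rightarrow> complex"
    and h :: "nat \<Rightarrow> 'h"
    and m :: int
    and \<mu> :: "'h \<Rightarrow> complex"
  assumes "affine_gcm n A"
    and "numerical_labels n A a"
    and "numerical_labels n (transposed A) av"
    and "realization n A scale \<alpha> h"
    and "m > 0"
    and "covers_in (dominant_weights_of_level n scale av h m) (weight_le n \<alpha>)
           \<mu> (\<lambda>x. \<mu> x - delta n a \<alpha> x)"
  shows
    "(\<exists>i. special_vertex n A a av i \<and> fundamental_weight n scale h i \<mu>) \<or>
     (\<not> triply_laced n A \<and>
        (\<exists>i. short_simple n A a av i \<and> (\<forall>j. short_simple n A a av j \<longrightarrow> j = i) \<and>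
             fundamental_weight n scale h i \<mu>)) \<or>
     (n \<ge> 2 \<and>
        (\<exists>\<sigma> \<omega>0 \<omega>n. numbering n A (mat_D_2 n) \<sigma> \<and>
           fundamental_weight n scale h (\<sigma> 0) \<omega>0 \<and> fundamental_weight n scale h (\<sigma> n) \<omega>n \<and>
           \<mu> = (\<lambda>x. \<omega>0 x + \<omega>n x))) \<or>
     (n = 1 \<and>
        (\<exists>\<sigma> \<omega>0 \<omega>1. numbering n A mat_A1_1 \<sigma> \<and>
           fundamental_weight n scale h (\<sigma> 0) \<omega>0 \<and> fundamental_weight n scale h (\<sigma> 1) \<omega>1 \<and>
           \<mu> = (\<lambda>x. \<omega>0 x + \<omega>1 x)))"
proof -
  interpret affine_diagram n A a av
    using assms(1-3) by unfold_locales (auto simp: affine_gcm_def)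
  obtain c where "covered_weight n A a av c" and c: "\<And>i. i \<le> n \<Longrightarrow> \<mu> (h i) = of_nat (c i)"
    using covering_imp_covered_weight[OF assms(4-6)] by blast
  then interpret covered_weight n A a av c by simp
  have \<mu>: "\<mu> \<in> dual_space scale"
    using assms(6) by (simp add: covers_in_def dominant_weights_of_level_def dominant_weights_def)
  obtain j where j: "j \<le> n" "c j \<noteq> 0" using c_nonzero by blast
  show ?thesis
  proof (cases "\<exists>i\<le>n. i \<noteq> j \<and> c i \<noteq> 0")
    case True
    then obtain i where "i \<le> n" "i \<noteq> j" "c i \<noteq> 0" by blast
    then obtain \<sigma> where \<sigma>: "numbering n A (if n = 1 then mat_A1_1 else mat_D_2 n) \<sigma>"
      "\<And>i. i \<le> n \<Longrightarrow> c (\<sigma> i) = (if i = 0 \<or> i = n then 1 else 0)"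
      using two_supports[of i j] j by metis
    have bij: "bij_betw \<sigma> {..n} {..n}" using \<sigma>(1) by (simp add: numbering_def)
    have ends: "\<sigma> 0 \<le> n" "\<sigma> n \<le> n" "\<sigma> 0 \<noteq> \<sigma> n"
      using bij_betwE[OF bij] n_pos inj_on_eq_iff[OF bij_betw_imp_inj_on[OF bij], of 0 n] by auto
    have "\<mu> (h k) = (if k = \<sigma> 0 \<or> k = \<sigma> n then 1 else 0)" if "k \<le> n" for k
    proof -
      have "k \<in> \<sigma> ` {..n}" using bij that by (simp add: bij_betw_def)
      then obtain l where "k = \<sigma> l" "l \<le> n" by auto
      then show ?thesis
        using c[OF that] \<sigma>(2)[of l] inj_on_eq_iff[OF bij_betw_imp_inj_on[OF bij], of l] by auto
    qed
    then obtain \<omega>0 \<omega>n where "fundamental_weight n scale h (\<sigma> 0) \<omega>0"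
      "fundamental_weight n scale h (\<sigma> n) \<omega>n" "\<mu> = (\<lambda>x. \<omega>0 x + \<omega>n x)"
      using split_fundamental_weights[OF assms(4) \<mu> ends] by blast
    moreover have "n = 1 \<and> numbering n A mat_A1_1 \<sigma> \<or> 2 \<le> n \<and> numbering n A (mat_D_2 n) \<sigma>"
      using \<sigma>(1) n_pos by (auto split: if_splits)
    ultimately show ?thesis by metis
  next
    case False
    have cj: "c j = 1" using c_le_1[OF j(1)] j(2) by simp
    have c0: "c i = 0" if "i \<le> n" "i \<noteq> j" for i using False that by blast
    have fund: "fundamental_weight n scale h j \<mu>"
      using \<mu> c cj c0 by (simp add: fundamental_weight_def)
    show ?thesis
    proof (cases "special_vertex n A a av j")
      case True
      then show ?thesis using fund by blast
    next
      case False
      then have short: "d j < d i" if "i \<le> n" "i \<noteq> j" for i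
        using single_support[OF j(1) cj c0 that] by blast
      then have "\<not> triply_laced n A" by (intro not_triply_laced[of j] j)
      moreover have "short_simple n A a av j"
        using j short by (auto simp: short_simple_def sq_simple intro: less_imp_le)
      moreover have "i = j" if "short_simple n A a av i" for i
        using that short[of i] j by (force simp: short_simple_def sq_simple)
      ultimately show ?thesis using fund by blast
    qed
  qed
qed

end
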